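(* Let $\vec p=(p_1,\ldots,p_n)$ with $0<p_i<\infty$ for every $i$, let $0<u\le\infty$ and $0<t<\min(p_1,\ldots,p_n,u)$. Then there is a constant $C>0$ such that for every sequence $\{f_j\}_{j=1}^\infty\subset L^0(\mathbb R^n)$, $$\left\|\left(\sum_{j=1}^\infty[\mathcal M_tf_j]^u\right)^{1/u}\right\|_{\vec p}\le C\left\|\left(\sum_{j=1}^\infty|f_j|^u\right)^{1/u}\right\|_{\vec p}$$ (with $\left(\sum_j|a_j|^u\right)^{1/u}$ replaced by $\sup_j|a_j|$ when $u=\infty$).
   Context: $L^0(\mathbb R^n)$ is the set of (complex-valued) measurable functions on $\mathbb R^n$. For $\vec p\in(0,\infty)^n$ the mixed Lebesgue norm is $$\|f\|_{\vec p}=\left(\int_{\mathbb R}\cdots\left(\int_{\mathbb R}\left(\int_{\mathbb R}|f(x_1,\ldots,x_n)|^{p_1}\,dx_1\right)^{p_2/p_1}dx_2\right)^{p_3/p_2}\cdots dx_n\right)^{1/p_n}.$$ For $1\le k\le n$ the one-dimensional maximal operator in the $k$-th variable is $M_kf(x)=\sup_{I\ni x_k}\frac1{|I|}\int_I|f(x_1,\ldots,y_k,\ldots,x_n)|\,dy_k$ (supremum over intervals $I\subset\mathbb R$ containing $x_k$). For $t>0$ the iterated maximal operator is $\mathcal M_tf(x)=\left(M_n\cdots M_1[|f|^t](x)\right)^{1/t}$. *)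

theory Defs
  imports "HOL-Analysis.Analysis"
begin

text \<open>
  The dimension \<open>n\<close> is a number, since \<open>\<M>\<^sub>t\<close> and the mixed norm are built up one variable at a time.
  A point of \<open>\<real>\<^sup>n\<close> is an extensional function on \<open>{1..n}\<close>, and \<open>\<real>\<^sup>n\<close> carries the completion of the
  product measure \<open>\<Pi>\<^sub>M i\<in>{1..n}. lborel\<close>, i.e. Lebesgue measure.
\<close>

definition L0 :: "nat \<Rightarrow> ((nat \<Rightarrow> real) \<Rightarrow> complex) set" where
  "L0 n = borel_measurable (completion (\<Pi>\<^sub>M i\<in>{1..n}. lborel))"

text \<open>Powers \<open>a\<^sup>r\<close> in \<open>[0,\<infinity>]\<close>, only meaningful for \<open>r > 0\<close>; then \<open>0\<^sup>r = 0\<close> and \<open>\<infinity>\<^sup>r = \<infinity>\<close>.\<close>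

definition enn_powr :: "ennreal \<Rightarrow> real \<Rightarrow> ennreal"  (infixr "powr\<^sub>e" 80) where
  "a powr\<^sub>e r = (if a = \<infinity> then \<infinity> else ennreal (enn2real a powr r))"

text \<open>
  \<open>mixed_int p k F x\<close> is the bracket inside the mixed norm obtained after integrating out the
  variables \<open>1, \<dots>, k\<close> (innermost first); it depends only on the coordinates of \<open>x\<close> above \<open>k\<close>.
  For \<open>F \<in> [0,\<infinity>]\<close> measurable with respect to the completion, a section of \<open>F\<close> may fail to be
  measurable for a null set of the remaining variables; \<open>nn_integral\<close> then returns the lower integral,
  which does not affect the outer integrals.  For Lebesgue measurable integrands, \<open>nn_integral\<close> over
  \<open>lborel\<close> is the Lebesgue integral (\<open>nn_integral_completion\<close>).
\<close>

fun mixed_int :: "(nat \<Rightarrow> real) \<Rightarrow> nat \<Rightarrow> ((nat \<Rightarrow> real) \<Rightarrow> ennreal) \<Rightarrow> (nat \<Rightarrow> real) \<Rightarrow> ennreal" where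
  "mixed_int p 0 F x = F x"
| "mixed_int p (Suc k) F x =
     (\<integral>\<^sup>+ y. mixed_int p k F (x(Suc k := y)) powr\<^sub>e (if k = 0 then p 1 else p (Suc k) / p k) \<partial>lborel)"

text \<open>
  The mixed norm of a function whose absolute value is \<open>F\<close>.  All coordinates of the base point
  in \<open>{1..n}\<close> get overwritten, and it is \<open>undefined\<close> elsewhere, so \<open>F\<close> is evaluated on \<open>\<real>\<^sup>n\<close> only.
\<close>

definition mixed_norm :: "nat \<Rightarrow> (nat \<Rightarrow> real) \<Rightarrow> ((nat \<Rightarrow> real) \<Rightarrow> ennreal) \<Rightarrow> ennreal" where
  "mixed_norm n p F = mixed_int p n F (\<lambda>_. undefined) powr\<^sub>e (1 / p n)"

text \<open>Averages are taken over the intervals (open, closed or half-open) of finite positive length.\<close>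

definition maximal_op ::
    "nat \<Rightarrow> ((nat \<Rightarrow> real) \<Rightarrow> ennreal) \<Rightarrow> (nat \<Rightarrow> real) \<Rightarrow> ennreal" where
  "maximal_op k F x =
     (SUP I \<in> {I :: real set. is_interval I \<and> x k \<in> I \<and> 0 < emeasure lborel I \<and> emeasure lborel I < \<infinity>}.
        (\<integral>\<^sup>+ y \<in> I. F (x(k := y)) \<partial>lborel) / emeasure lborel I)"

text \<open>\<open>iter_maximal n\<close> is \<open>M\<^sub>n \<cdots> M\<^sub>1\<close>, with \<open>M\<^sub>1\<close> applied first.\<close>

fun iter_maximal :: "nat \<Rightarrow> ((nat \<Rightarrow> real) \<Rightarrow> ennreal) \<Rightarrow> (nat \<Rightarrow> real) \<Rightarrow> ennreal" where
  "iter_maximal 0 F = F"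
| "iter_maximal (Suc k) F = maximal_op (Suc k) (iter_maximal k F)"

definition maximal_t ::
    "nat \<Rightarrow> real \<Rightarrow> ((nat \<Rightarrow> real) \<Rightarrow> complex) \<Rightarrow> (nat \<Rightarrow> real) \<Rightarrow> ennreal" where
  "maximal_t n t f x = iter_maximal n (\<lambda>y. ennreal (cmod (f y)) powr\<^sub>e t) x powr\<^sub>e (1 / t)"

definition lu_norm :: "ennreal \<Rightarrow> (nat \<Rightarrow> ennreal) \<Rightarrow> ennreal" where
  "lu_norm u a =
     (if u = \<infinity> then SUP j. a j else (\<Sum>j. a j powr\<^sub>e enn2real u) powr\<^sub>e (1 / enn2real u))"

end

theory Submission
  imports Defs
begin

text \<open>
  Taking \<open>t\<close>-th powers reduces the claim to the following one for \<open>g\<^sub>j = \<bar>f\<^sub>j\<bar>\<^sup>t\<close>,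
  \<open>q = p/t\<close> and \<open>v = u/t\<close>: if all \<open>q\<^sub>i\<close> lie in \<open>(1,\<infinity>)\<close> and \<open>v \<in> (1,\<infinity>]\<close>, then
  \<open>M\<^sub>n \<cdots> M\<^sub>1\<close> is bounded on \<open>L\<^sup>q(l\<^sup>v)\<close>.  It suffices to bound each \<open>M\<^sub>k\<close> there, and, since the
  mixed norm is monotone in the norm of the first \<open>k\<close> variables, to bound the one-dimensional
  maximal operator on functions of \<open>x\<^sub>k\<close> with values in
  \<open>L\<^sup>q(x\<^sub>1, \<dots>, x\<^sub>k\<^sub>-\<^sub>1; l\<^sup>v)\<close>.

  This is done by extrapolation.  Say that a pair \<open>(F, G)\<close> of functions on the line satisfies the
  weighted bound with exponent \<open>r\<close> if \<open>\<integral> F\<^sup>r w \<le> N \<integral> G\<^sup>r w\<close> for all Muckenhoupt weights \<open>w\<close>, with \<open>N\<close>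
  controlled by the constants of \<open>w\<close>.  Rubio de Francia's theorem (\<open>extrapolation\<close>) says that
  the bound for one \<open>r > 1\<close> implies the bound for every exponent \<open>q > 1\<close>.  For scalar functions the
  bound holds (\<open>maximal_weighted\<close>); with \<open>r = v\<close> it can be summed over \<open>j\<close>, which gives the norms in
  \<open>l\<^sup>v\<close> (for \<open>v = \<infinity>\<close> the supremum is simply moved inside the maximal operator).  If the bound is
  known for the norm in the variables \<open>1, \<dots>, i\<close>, extrapolation allows the exponent \<open>r = q\<^sub>i\<^sub>+\<^sub>1\<close>, and for
  that exponent Fubini's theorem adds the variable \<open>i + 1\<close> (\<open>weighted_bound_Fubini\<close>).  After \<open>k - 1\<close>
  such steps, the exponent \<open>q\<^sub>k\<close> and the weight \<open>1\<close> give the estimate for \<open>M\<^sub>k\<close>.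

  Two choices keep the weight theory elementary.  By Jones' factorization a Muckenhoupt weight of class
  \<open>A\<^sub>r\<close> has the form \<open>a\<^sup>1\<^sup>-\<^sup>r b\<close> with \<open>a, b\<close> of class \<open>A\<^sub>1\<close>; all weights below
  are given in this form.  And the scalar weighted bound follows, by an argument of Lerner, from the fact that on the line the
  maximal operator over intervals is bounded on \<open>L\<^sup>p(\<mu>)\<close> for \<^emph>\<open>every\<close> locally finite
  measure \<open>\<mu>\<close> that is positive on intervals, with a constant depending on \<open>p\<close> alone.

  All this needs Borel functions, whereas the \<open>f\<^sub>j\<close> are Lebesgue measurable.  Replacing them by Borel
  versions changes neither side: \<open>M\<^sub>k\<close> and the \<open>k\<close>-th integration both see the function only up to
  null sets of the \<open>k\<close>-th variable, so that after all \<open>n\<close> variables nothing of the exceptional null set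
  is left.
\<close>

section \<open>Powers in \<open>[0,\<infinity>]\<close>\<close>

lemma enn_powr_ennreal: "0 \<le> x \<Longrightarrow> ennreal x powr\<^sub>e r = ennreal (x powr r)"
  by (simp add: enn_powr_def)

lemma enn_powr_top [simp]: "top powr\<^sub>e r = top"
  by (simp add: enn_powr_def)

lemma enn_powr_zero [simp]: "0 powr\<^sub>e r = 0"
  by (simp add: enn_powr_def)

lemma enn_powr_1 [simp]: "a powr\<^sub>e 1 = a"
  by (cases a) (auto simp: enn_powr_def)

lemma enn_powr_mono: "0 \<le> r \<Longrightarrow> a \<le> b \<Longrightarrow> a powr\<^sub>e r \<le> b powr\<^sub>e r"
  by (cases a; cases b) (auto simp: enn_powr_def top_unique powr_mono2 intro!: ennreal_leI)

lemma enn_powr_powr: "(a powr\<^sub>e r) powr\<^sub>e s = a powr\<^sub>e (r * s)"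
  by (cases a) (auto simp: enn_powr_def powr_powr)

lemma enn_powr_add: "a powr\<^sub>e (r + s) = a powr\<^sub>e r * a powr\<^sub>e s"
  by (cases a) (auto simp: enn_powr_def powr_add ennreal_mult)

lemma enn_powr_eq_0_iff [simp]: "a powr\<^sub>e r = 0 \<longleftrightarrow> a = 0"
  by (cases a) (auto simp: enn_powr_def)

lemma enn_powr_mult: "0 < r \<Longrightarrow> (a * b) powr\<^sub>e r = a powr\<^sub>e r * b powr\<^sub>e r"
proof (cases a; cases b)
  fix x y assume "a = ennreal x" "0 \<le> x" "b = ennreal y" "0 \<le> y"
  then show ?thesis
    by (simp add: ennreal_mult[symmetric] enn_powr_ennreal powr_mult)
qed (auto simp: ennreal_top_mult ennreal_mult_top)

lemma enn_powr_measurable [measurable]: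
  "f \<in> borel_measurable M \<Longrightarrow> (\<lambda>x. f x powr\<^sub>e r) \<in> borel_measurable M"
proof -
  assume [measurable]: "f \<in> borel_measurable M"
  have [measurable]: "{x\<in>space M. f x = \<infinity>} \<in> sets M"
    using measurable_sets[of f M borel "{\<infinity>}"] by (simp add: vimage_def Int_def conj_commute)
  show ?thesis unfolding enn_powr_def
    by (intro measurable_If) measurable
qed

lemma enn_powr_le_iff:
  assumes "0 < r"
  shows "a powr\<^sub>e r \<le> b \<longleftrightarrow> a \<le> b powr\<^sub>e (1 / r)"
  using enn_powr_mono[of "1/r" "a powr\<^sub>e r" b] enn_powr_mono[of r a "b powr\<^sub>e (1/r)"] assms
  by (auto simp: enn_powr_powr)

lemma SUP_enn_powr:
  assumes "0 < r"
  shows "(SUP i\<in>A. f i) powr\<^sub>e r = (SUP i\<in>A. f i powr\<^sub>e r)"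
proof (rule antisym)
  show "(SUP i\<in>A. f i) powr\<^sub>e r \<le> (SUP i\<in>A. f i powr\<^sub>e r)"
    unfolding enn_powr_le_iff[OF assms]
    by (rule SUP_least) (auto simp: enn_powr_le_iff[OF assms, symmetric] intro: SUP_upper)
  show "(SUP i\<in>A. f i powr\<^sub>e r) \<le> (SUP i\<in>A. f i) powr\<^sub>e r"
    by (rule SUP_least) (auto intro!: enn_powr_mono SUP_upper simp: assms less_imp_le)
qed

section \<open>The maximal function of a measure on the line\<close>

text \<open>
  Open intervals with rational endpoints suffice in the supremum that defines the maximal operator, since
  an interval of positive length is contained in such intervals of nearly the same length.  Being countably many,
  they make measurability and the passage to countable unions immediate.
\<close>

definition rat_ivls :: "real set set" where
  "rat_ivls = (\<lambda>(a, b). {real_of_rat a<..<real_of_rat b}) ` UNIV"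

lemma countable_rat_ivls [simp]: "countable rat_ivls"
  unfolding rat_ivls_def by (intro countable_image) (rule countableI_type)

lemma rat_ivls_borel [measurable]: "I \<in> rat_ivls \<Longrightarrow> I \<in> sets borel"
  by (auto simp: rat_ivls_def)

text \<open>
  The uncentered maximal function of \<open>g\<close> with respect to \<open>\<mu>\<close>: averages are formed with \<open>\<mu>\<close> in place of
  Lebesgue measure.
\<close>

definition wmax :: "real measure \<Rightarrow> (real \<Rightarrow> ennreal) \<Rightarrow> real \<Rightarrow> ennreal" where
  "wmax \<mu> g x = (SUP I\<in>{I\<in>rat_ivls. x \<in> I}. (\<integral>\<^sup>+y\<in>I. g y \<partial>\<mu>) / emeasure \<mu> I)"

text \<open>
  Among three intervals with a common point, the one that reaches furthest to the left and the one that reaches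
  furthest to the right cover the remaining one.  This is special to dimension one, and it is what makes the
  maximal theorem below hold for arbitrary measures.
\<close>

lemma three_intervals:
  fixes x :: real
  assumes "x \<in> {a1<..<b1}" "x \<in> {a2<..<b2}" "x \<in> {a3<..<b3}"
  shows "{a1<..<b1} \<subseteq> {a2<..<b2} \<union> {a3<..<b3} \<or> {a2<..<b2} \<subseteq> {a1<..<b1} \<union> {a3<..<b3}
     \<or> {a3<..<b3} \<subseteq> {a1<..<b1} \<union> {a2<..<b2}"
proof (rule ccontr)
  assume "\<not> ?thesis"
  then obtain y1 y2 y3 where y: "y1 \<in> {a1<..<b1} - ({a2<..<b2} \<union> {a3<..<b3})"
    "y2 \<in> {a2<..<b2} - ({a1<..<b1} \<union> {a3<..<b3})" "y3 \<in> {a3<..<b3} - ({a1<..<b1} \<union> {a2<..<b2})"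
    by blast
  show False
    using assms y
    by (simp add: not_less) (smt (verit))
qed

text \<open>
  A subfamily of minimal cardinality with the same union has overlap at most \<open>2\<close>: by \<open>three_intervals\<close>, of
  three members through one point, one could be dropped.
\<close>

lemma interval_subcover:
  assumes fin: "finite \<I>" and "\<I> \<subseteq> rat_ivls"
  obtains \<J> where "\<J> \<subseteq> \<I>" "\<Union>\<J> = \<Union>\<I>" "\<And>x. card {J\<in>\<J>. x \<in> J} \<le> 2"
proof -
  let ?P = "\<lambda>\<J>. \<J> \<subseteq> \<I> \<and> \<Union>\<J> = \<Union>\<I>"
  obtain \<J> where J: "?P \<J>" and min: "\<And>\<K>. ?P \<K> \<Longrightarrow> card \<J> \<le> card \<K>"
    using ex_has_least_nat[of ?P \<I> card] by blast
  have finJ: "finite \<J>" using J fin finite_subset by blast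
  have "card {J\<in>\<J>. x \<in> J} \<le> 2" for x
  proof (rule ccontr)
    assume "\<not> ?thesis"
    then have "3 \<le> card {J\<in>\<J>. x \<in> J}" by simp
    then obtain T where T: "T \<subseteq> {J\<in>\<J>. x \<in> J}" "card T = 3"
      by (meson obtain_subset_with_card_n)
    then obtain A B C where ABC: "T = {A, B, C}" "A \<noteq> B" "B \<noteq> C" "A \<noteq> C"
      by (auto simp: card_3_iff)
    have red: "\<not> X \<subseteq> Y \<union> Z" if "X \<in> \<J>" "Y \<in> \<J>" "Z \<in> \<J>" "X \<noteq> Y" "X \<noteq> Z" for X Y Z
    proof
      assume "X \<subseteq> Y \<union> Z"
      then have "\<Union>(\<J> - {X}) = \<Union>\<J>" using that by blast
      with J have "?P (\<J> - {X})" by auto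
      from min[OF this] show False
        using that(1) finJ by (metis card_Diff1_less leD)
    qed
    have mem: "A \<in> \<J>" "B \<in> \<J>" "C \<in> \<J>" "x \<in> A" "x \<in> B" "x \<in> C" using T ABC by auto
    then have "A \<in> rat_ivls" "B \<in> rat_ivls" "C \<in> rat_ivls" using J assms(2) by auto
    then obtain a1 b1 a2 b2 a3 b3 :: real where "A = {a1<..<b1}" "B = {a2<..<b2}" "C = {a3<..<b3}"
      unfolding rat_ivls_def by auto
    with three_intervals[of x a1 b1 a2 b2 a3 b3] mem
    have "A \<subseteq> B \<union> C \<or> B \<subseteq> A \<union> C \<or> C \<subseteq> A \<union> B" by simp
    with red mem ABC show False by metis
  qed
  with J that show ?thesis by blast
qed

text \<open>
  The weak type estimate for finitely many intervals.  Over a subcover of overlap at most \<open>2\<close>, both sides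
  can be summed, at the price of a factor \<open>2\<close>.
\<close>

lemma finite_cover_estimate:
  fixes \<mu> :: "real measure"
  assumes [measurable_cong]: "sets \<mu> = sets borel" and [measurable]: "g \<in> borel_measurable borel"
    and "finite \<I>" "\<I> \<subseteq> rat_ivls"
    and avg: "\<And>I. I \<in> \<I> \<Longrightarrow> l * emeasure \<mu> I \<le> (\<integral>\<^sup>+y\<in>I. g y \<partial>\<mu>)"
  shows "l * emeasure \<mu> (\<Union>\<I>) \<le> 2 * (\<integral>\<^sup>+y. g y \<partial>\<mu>)"
proof -
  obtain \<J> where J: "\<J> \<subseteq> \<I>" "\<Union>\<J> = \<Union>\<I>" "\<And>x. card {J\<in>\<J>. x \<in> J} \<le> 2"
    using interval_subcover[OF assms(3,4)] by blast
  have finJ: "finite \<J>" using J assms(3) finite_subset by blast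
  have m: "I \<in> sets borel" if "I \<in> \<J>" for I using that J assms(4) by auto
  have overlap: "(\<Sum>I\<in>\<J>. indicator I y) \<le> (2::ennreal)" for y
  proof -
    have "(\<Sum>I\<in>\<J>. indicator I y) = (\<Sum>I\<in>{J\<in>\<J>. y \<in> J}. (1::ennreal))"
      by (intro sum.mono_neutral_cong_right finJ) (auto simp: indicator_def)
    also have "\<dots> = of_nat (card {J\<in>\<J>. y \<in> J})" by simp
    also have "\<dots> \<le> of_nat 2" using J(3)[of y] of_nat_mono by blast
    finally show ?thesis by simp
  qed
  have "l * emeasure \<mu> (\<Union>\<I>) = l * emeasure \<mu> (\<Union>I\<in>\<J>. I)" using J by simp
  also have "\<dots> \<le> l * (\<Sum>I\<in>\<J>. emeasure \<mu> I)"
    by (intro mult_left_mono emeasure_subadditive_finite finJ) (auto simp: assms(1) m)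
  also have "\<dots> \<le> (\<Sum>I\<in>\<J>. \<integral>\<^sup>+y\<in>I. g y \<partial>\<mu>)"
    unfolding sum_distrib_left using J by (intro sum_mono avg) auto
  also have "\<dots> = (\<integral>\<^sup>+y. (\<Sum>I\<in>\<J>. g y * indicator I y) \<partial>\<mu>)"
    by (rule nn_integral_sum[symmetric]) (use m in measurable)
  also have "\<dots> = (\<integral>\<^sup>+y. g y * (\<Sum>I\<in>\<J>. indicator I y) \<partial>\<mu>)"
    by (simp add: sum_distrib_left)
  also have "\<dots> \<le> (\<integral>\<^sup>+y. g y * 2 \<partial>\<mu>)"
    by (intro nn_integral_mono mult_left_mono overlap) auto
  also have "\<dots> = 2 * (\<integral>\<^sup>+y. g y \<partial>\<mu>)"
    by (simp add: nn_integral_multc mult.commute)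
  finally show ?thesis .
qed


lemma ex_rat_ivl:
  assumes "s \<le> S" "0 < e"
  obtains I where "I \<in> rat_ivls" "{s..S} \<subseteq> I" "emeasure lborel I \<le> ennreal (S - s + e)"
proof -
  obtain a where a: "s - e/2 < real_of_rat a" "real_of_rat a < s"
    using of_rat_dense[of "s - e/2" s] assms by auto
  obtain b where b: "S < real_of_rat b" "real_of_rat b < S + e/2"
    using of_rat_dense[of S "S + e/2"] assms by auto
  show ?thesis
  proof
    show "{real_of_rat a<..<real_of_rat b} \<in> rat_ivls" by (auto simp: rat_ivls_def)
  qed (use a b assms in \<open>auto intro!: ennreal_leI simp del: ennreal_plus\<close>)
qed

lemma Union_rat_ivls: "\<Union>rat_ivls = UNIV"
proof safe
  fix x :: real
  obtain I where "I \<in> rat_ivls" "{x..x} \<subseteq> I" using ex_rat_ivl[of x x 1] by auto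
  then show "x \<in> \<Union>rat_ivls" by auto
qed auto

lemma wmax_eq_SUP_indicator:
  "wmax \<mu> g x = (SUP I\<in>rat_ivls. ((\<integral>\<^sup>+y\<in>I. g y \<partial>\<mu>) / emeasure \<mu> I) * indicator I x)"
proof (rule antisym)
  show "wmax \<mu> g x \<le> (SUP I\<in>rat_ivls. ((\<integral>\<^sup>+y\<in>I. g y \<partial>\<mu>) / emeasure \<mu> I) * indicator I x)"
    unfolding wmax_def by (intro SUP_mono) (auto simp: indicator_def)
  show "(SUP I\<in>rat_ivls. ((\<integral>\<^sup>+y\<in>I. g y \<partial>\<mu>) / emeasure \<mu> I) * indicator I x) \<le> wmax \<mu> g x"
    unfolding wmax_def by (intro SUP_least) (auto simp: indicator_def intro: SUP_upper)
qed

lemma wmax_measurable [measurable]: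
  assumes [measurable_cong]: "sets N = sets borel"
  shows "wmax \<mu> g \<in> borel_measurable N"
  unfolding wmax_eq_SUP_indicator[abs_def] by measurable

lemma ennreal_less_divide_iff:
  fixes z a m :: ennreal
  assumes "0 < m" "m < top"
  shows "z < a / m \<longleftrightarrow> z * m < a"
proof -
  have "a / m * m = a" using assms by (simp add: ennreal_divide_times)
  moreover have "z < a / m \<longleftrightarrow> z * m < a / m * m"
    using assms mult_right_mono[of "a / m" z m] ennreal_mult_strict_right_mono[of z "a / m" m]
    by (auto simp: not_le[symmetric])
  ultimately show ?thesis by simp
qed

text \<open>
  The measures for which every average over a nonempty rational interval makes sense.
\<close>

locale ivl_measure =
  fixes \<mu> :: "real measure"
  assumes sets_mu [measurable_cong, simp]: "sets \<mu> = sets borel"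
    and fin_ivl: "I \<in> rat_ivls \<Longrightarrow> emeasure \<mu> I < top"
    and pos_ivl: "I \<in> rat_ivls \<Longrightarrow> I \<noteq> {} \<Longrightarrow> 0 < emeasure \<mu> I"
begin

lemma space_mu [simp]: "space \<mu> = UNIV"
  using sets_eq_imp_space_eq[OF sets_mu] by simp

sublocale sigma_finite_measure \<mu>
proof
  show "\<exists>A. countable A \<and> A \<subseteq> sets \<mu> \<and> \<Union>A = space \<mu> \<and> (\<forall>a\<in>A. emeasure \<mu> a \<noteq> \<infinity>)"
    using fin_ivl by (intro exI[of _ rat_ivls]) (auto simp: Union_rat_ivls less_top)
qed

lemma wmax_gt_iff: "l < wmax \<mu> g x \<longleftrightarrow> (\<exists>I\<in>rat_ivls. x \<in> I \<and> l * emeasure \<mu> I < (\<integral>\<^sup>+y\<in>I. g y \<partial>\<mu>))"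
proof -
  have "l < (\<integral>\<^sup>+y\<in>I. g y \<partial>\<mu>) / emeasure \<mu> I \<longleftrightarrow> l * emeasure \<mu> I < (\<integral>\<^sup>+y\<in>I. g y \<partial>\<mu>)"
    if "I \<in> rat_ivls" "x \<in> I" for I
    using fin_ivl[of I] pos_ivl[of I] that
    by (intro ennreal_less_divide_iff) auto
  then show ?thesis by (auto simp: wmax_def less_SUP_iff)
qed

text \<open>
  The weak type \<open>(1,1)\<close> estimate, in the form needed for interpolation: the part of \<open>g\<close> below \<open>l/2\<close>
  contributes at most \<open>l/2\<close> to any average, hence an average above \<open>l\<close> forces the average of the remaining
  part above \<open>l/2\<close>.
\<close>

lemma weak_type:
  assumes [measurable]: "g \<in> borel_measurable borel" and l: "0 < l"
  shows "ennreal l * emeasure \<mu> {x. ennreal l < wmax \<mu> g x}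
    \<le> 4 * (\<integral>\<^sup>+y. g y * indicator {y. ennreal l < 2 * g y} y \<partial>\<mu>)"
proof -
  define g1 where "g1 y = g y * indicator {y. ennreal l < 2 * g y} y" for y
  have [measurable]: "g1 \<in> borel_measurable borel" unfolding g1_def by measurable
  define \<U> where "\<U> = {I\<in>rat_ivls. ennreal l * emeasure \<mu> I < (\<integral>\<^sup>+y\<in>I. g y \<partial>\<mu>)}"
  have eq: "{x. ennreal l < wmax \<mu> g x} = \<Union>\<U>"
    by (auto simp: wmax_gt_iff \<U>_def)
  have avg: "ennreal (l/2) * emeasure \<mu> I \<le> (\<integral>\<^sup>+y\<in>I. g1 y \<partial>\<mu>)" if "I \<in> \<U>" for I
  proof -
    have I: "I \<in> rat_ivls" "I \<in> sets borel" using that by (auto simp: \<U>_def)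
    have le: "g y \<le> g1 y + ennreal (l/2)" for y
    proof (cases "ennreal l < 2 * g y")
      case False
      then have "2 * g y \<le> 2 * ennreal (l/2)"
        using l by (simp add: not_less ennreal_mult'[of 2, simplified, symmetric])
      then have "g y \<le> ennreal (l/2)"
        by (simp add: ennreal_mult_le_mult_iff)
      then show ?thesis by (simp add: add_increasing)
    qed (simp add: g1_def)
    have "ennreal (l/2) * emeasure \<mu> I + ennreal (l/2) * emeasure \<mu> I = ennreal l * emeasure \<mu> I"
      using l by (simp add: distrib_right[symmetric] ennreal_plus[symmetric] del: ennreal_plus)
    also have "\<dots> \<le> (\<integral>\<^sup>+y\<in>I. g y \<partial>\<mu>)" using that by (simp add: \<U>_def less_imp_le)
    also have "\<dots> \<le> (\<integral>\<^sup>+y. g1 y * indicator I y + ennreal (l/2) * indicator I y \<partial>\<mu>)"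
      using le by (intro nn_integral_mono) (auto simp: indicator_def)
    also have "\<dots> = (\<integral>\<^sup>+y\<in>I. g1 y \<partial>\<mu>) + ennreal (l/2) * emeasure \<mu> I"
      using I by (subst nn_integral_add) (auto simp: nn_integral_cmult_indicator)
    finally show ?thesis
      using fin_ivl[OF I(1)] by (auto simp: ennreal_mult_eq_top_iff)
  qed
  have fincase: "ennreal (l/2) * emeasure \<mu> (\<Union>\<F>) \<le> 2 * (\<integral>\<^sup>+y. g1 y \<partial>\<mu>)"
    if "finite \<F>" "\<F> \<subseteq> \<U>" for \<F>
    using that by (intro finite_cover_estimate avg) (auto simp: \<U>_def)
  have "countable \<U>" unfolding \<U>_def by (rule countable_subset[OF _ countable_rat_ivls]) auto
  have main: "ennreal (l/2) * emeasure \<mu> (\<Union>\<U>) \<le> 2 * (\<integral>\<^sup>+y. g1 y \<partial>\<mu>)"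
  proof (cases "\<U> = {}")
    case False
    define E where "E = from_nat_into \<U>"
    have rE: "range E = \<U>" unfolding E_def using False \<open>countable \<U>\<close> by (rule range_from_nat_into)
    have mE: "E i \<in> sets borel" for i using rE rangeI[of E i] by (auto simp: \<U>_def)
    have "\<Union>\<U> = (\<Union>n. \<Union>i\<le>n. E i)" using rE by blast
    also have "emeasure \<mu> \<dots> = (SUP n. emeasure \<mu> (\<Union>i\<le>n. E i))"
      using mE by (intro SUP_emeasure_incseq[symmetric]) (auto simp: incseq_def; force)+
    finally have "ennreal (l/2) * emeasure \<mu> (\<Union>\<U>) = (SUP n. ennreal (l/2) * emeasure \<mu> (\<Union>i\<le>n. E i))"
      by (simp add: SUP_mult_left_ennreal)
    also have "\<dots> \<le> 2 * (\<integral>\<^sup>+y. g1 y \<partial>\<mu>)"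
      using rE by (intro SUP_least fincase) auto
    finally show ?thesis .
  qed simp
  have "ennreal l * emeasure \<mu> (\<Union>\<U>) = 2 * (ennreal (l/2) * emeasure \<mu> (\<Union>\<U>))"
    using l by (simp add: mult.assoc[symmetric] ennreal_mult'[of 2, simplified, symmetric])
  also have "\<dots> \<le> 2 * (2 * (\<integral>\<^sup>+y. g1 y \<partial>\<mu>))" by (intro mult_left_mono main) auto
  finally show ?thesis unfolding eq g1_def by (simp add: mult.assoc[symmetric])
qed

end

text \<open>
  \<open>z\<^sup>p/p = \<integral> l\<^sup>p\<^sup>-\<^sup>1 dl\<close> over \<open>0 < l < z\<close>, including \<open>z = \<infinity>\<close>.  It is used for both steps of the
  interpolation between the weak type estimate and \<open>L\<^sup>\<infinity>\<close>.
\<close>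

lemma layer_cake_powr:
  assumes "0 < p"
  shows "(\<integral>\<^sup>+l. ennreal (l powr (p - 1)) * indicator {l. 0 < l \<and> ennreal l < z} l \<partial>lborel)
    = z powr\<^sub>e p / ennreal p"
proof -
  have finite_case: "(\<integral>\<^sup>+l. ennreal (l powr (p - 1)) * indicator {l. 0 < l \<and> ennreal l < ennreal c} l \<partial>lborel)
    = ennreal c powr\<^sub>e p / ennreal p" if "0 \<le> c" for c
  proof -
    have ae: "AE l in lborel. l \<noteq> 0 \<and> l \<noteq> c"
      using AE_lborel_singleton[of 0] AE_lborel_singleton[of c] by eventually_elim auto
    have "(\<integral>\<^sup>+l. ennreal (l powr (p - 1)) * indicator {l. 0 < l \<and> ennreal l < ennreal c} l \<partial>lborel)
      = (\<integral>\<^sup>+l. indicator {0..c} l * ennreal (l powr (p - 1)) \<partial>lborel)"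
      by (intro nn_integral_cong_AE eventually_mono[OF ae])
        (auto simp: indicator_def ennreal_less_iff)
    also have "\<dots> = (\<integral>\<^sup>+l. ennreal (indicator {0..c} l * l powr (p - 1)) \<partial>lborel)"
      by (intro nn_integral_cong) (auto simp: indicator_def)
    also have "\<dots> = ennreal (c powr (p - 1 + 1) / (p - 1 + 1))"
      using assms that by (intro nn_integral_has_integral_lebesgue has_integral_powr_from_0) auto
    finally show ?thesis using assms that
      by (simp add: enn_powr_ennreal divide_ennreal)
  qed
  show ?thesis
  proof (cases z)
    case (real c)
    then show ?thesis using finite_case by simp
  next
    case top
    let ?J = "\<integral>\<^sup>+l. ennreal (l powr (p - 1)) * indicator {l. 0 < l \<and> ennreal l < z} l \<partial>lborel"
    have "ennreal c powr\<^sub>e p / ennreal p \<le> ?J" if "0 \<le> c" for c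
      unfolding finite_case[OF that, symmetric] top
      by (intro nn_integral_mono mult_left_mono) (auto simp: indicator_def)
    note level = this
    have le: "ennreal c \<le> ?J" if "0 \<le> c" for c
      using level[of "(c * p) powr (1 / p)"] assms that by (simp add: enn_powr_ennreal powr_powr divide_ennreal)
    have "?J = top"
    proof (cases ?J)
      case (real r)
      with le[of "r + 1"] show ?thesis by (simp add: )
    qed simp
    with top assms show ?thesis by (simp add: ennreal_top_divide)
  qed
qed

context ivl_measure
begin

text \<open>
  Marcinkiewicz interpolation.  Writing \<open>(M\<^sub>\<mu> g)\<^sup>p\<close> as a layer-cake integral and inserting the weak type
  estimate leaves an integral of \<open>g(x) l\<^sup>p\<^sup>-\<^sup>2\<close> over \<open>0 < l < 2 g(x)\<close>, which is a multiple of \<open>g(x)\<^sup>p\<close>.  The constant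
  does not depend on \<open>\<mu>\<close>.
\<close>

lemma strong_type:
  assumes p: "1 < p" and [measurable]: "g \<in> borel_measurable borel"
  shows "(\<integral>\<^sup>+x. wmax \<mu> g x powr\<^sub>e p \<partial>\<mu>)
    \<le> ennreal (p * 4 * 2 powr (p - 1) / (p - 1)) * (\<integral>\<^sup>+x. g x powr\<^sub>e p \<partial>\<mu>)"
proof -
  interpret P: pair_sigma_finite \<mu> "lborel :: real measure" ..
  have 1: "wmax \<mu> g x powr\<^sub>e p = ennreal p * (\<integral>\<^sup>+l. ennreal (l powr (p - 1)) *
       indicator {l. 0 < l \<and> ennreal l < wmax \<mu> g x} l \<partial>lborel)" for x
    using p by (simp add: layer_cake_powr ennreal_times_divide ennreal_mult_divide_eq
          mult.commute[of "ennreal p"])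
  have "(\<integral>\<^sup>+x. wmax \<mu> g x powr\<^sub>e p \<partial>\<mu>)
     = ennreal p * (\<integral>\<^sup>+x. (\<integral>\<^sup>+l. ennreal (l powr (p - 1)) *
       indicator {l. 0 < l \<and> ennreal l < wmax \<mu> g x} l \<partial>lborel) \<partial>\<mu>)"
    unfolding 1 by (rule nn_integral_cmult) measurable
  also have "(\<integral>\<^sup>+x. (\<integral>\<^sup>+l. ennreal (l powr (p - 1)) *
       indicator {l. 0 < l \<and> ennreal l < wmax \<mu> g x} l \<partial>lborel) \<partial>\<mu>)
     = (\<integral>\<^sup>+l. (\<integral>\<^sup>+x. ennreal (l powr (p - 1)) *
       indicator {l. 0 < l \<and> ennreal l < wmax \<mu> g x} l \<partial>\<mu>) \<partial>lborel)"
    by (rule P.Fubini'[symmetric]) measurable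
  also have "\<dots> \<le> (\<integral>\<^sup>+l. (\<integral>\<^sup>+x. 4 * (g x * (ennreal (l powr (p - 2)) *
       indicator {l. 0 < l \<and> ennreal l < 2 * g x} l)) \<partial>\<mu>) \<partial>lborel)"
  proof (rule nn_integral_mono)
    fix l :: real
    show "(\<integral>\<^sup>+x. ennreal (l powr (p - 1)) * indicator {l. 0 < l \<and> ennreal l < wmax \<mu> g x} l \<partial>\<mu>)
      \<le> (\<integral>\<^sup>+x. 4 * (g x * (ennreal (l powr (p - 2)) * indicator {l. 0 < l \<and> ennreal l < 2 * g x} l)) \<partial>\<mu>)"
    proof (cases "0 < l")
      case True
      then have "l powr (p - 1) = l powr (p - 2) * l"
        by (simp add: powr_diff powr_add[symmetric] field_simps power2_eq_square powr_numeral)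
      then have lp: "ennreal (l powr (p - 1)) = ennreal (l powr (p - 2)) * ennreal l"
        using True by (simp add: ennreal_mult)
      have "(\<integral>\<^sup>+x. ennreal (l powr (p - 1)) * indicator {l. 0 < l \<and> ennreal l < wmax \<mu> g x} l \<partial>\<mu>)
        = (\<integral>\<^sup>+x. ennreal (l powr (p - 1)) * indicator {x. ennreal l < wmax \<mu> g x} x \<partial>\<mu>)"
        using True by (intro nn_integral_cong) (auto simp: indicator_def)
      also have "\<dots> = ennreal (l powr (p - 1)) * emeasure \<mu> {x. ennreal l < wmax \<mu> g x}"
        by (rule nn_integral_cmult_indicator) measurable
      also have "\<dots> = ennreal (l powr (p - 2)) * (ennreal l * emeasure \<mu> {x. ennreal l < wmax \<mu> g x})"
        unfolding lp by (simp add: mult.assoc)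
      also have "\<dots> \<le> ennreal (l powr (p - 2)) *
          (4 * (\<integral>\<^sup>+y. g y * indicator {y. ennreal l < 2 * g y} y \<partial>\<mu>))"
        by (intro mult_left_mono weak_type True) auto
      also have "\<dots> = (\<integral>\<^sup>+y. ennreal (l powr (p - 2)) * (4 * (g y * indicator {y. ennreal l < 2 * g y} y)) \<partial>\<mu>)"
        by (simp add: nn_integral_cmult)
      also have "\<dots> = (\<integral>\<^sup>+x. 4 * (g x * (ennreal (l powr (p - 2)) * indicator {l. 0 < l \<and> ennreal l < 2 * g x} l)) \<partial>\<mu>)"
        using True by (intro nn_integral_cong) (auto simp: indicator_def mult_ac)
      finally show ?thesis .
    qed simp
  qed
  also have "\<dots> = (\<integral>\<^sup>+x. (\<integral>\<^sup>+l. 4 * (g x * (ennreal (l powr (p - 2)) *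
       indicator {l. 0 < l \<and> ennreal l < 2 * g x} l)) \<partial>lborel) \<partial>\<mu>)"
    by (rule P.Fubini') measurable
  also have "\<dots> = (\<integral>\<^sup>+x. ennreal (4 * 2 powr (p - 1) / (p - 1)) * g x powr\<^sub>e p \<partial>\<mu>)"
  proof (rule nn_integral_cong)
    fix x
    have "(\<integral>\<^sup>+l. 4 * (g x * (ennreal (l powr (p - 2)) * indicator {l. 0 < l \<and> ennreal l < 2 * g x} l)) \<partial>lborel)
      = 4 * (g x * (\<integral>\<^sup>+l. ennreal (l powr (p - 1 - 1)) * indicator {l. 0 < l \<and> ennreal l < 2 * g x} l \<partial>lborel))"
      by (simp add: nn_integral_cmult)
    also have "\<dots> = 4 * (g x * ((2 * g x) powr\<^sub>e (p - 1) / ennreal (p - 1)))"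
      using p by (subst layer_cake_powr) auto
    also have "\<dots> = (4 * (2 powr\<^sub>e (p - 1) / ennreal (p - 1))) * (g x powr\<^sub>e 1 * g x powr\<^sub>e (p - 1))"
      using p by (simp add: enn_powr_mult divide_ennreal_def mult_ac)
    also have "g x powr\<^sub>e 1 * g x powr\<^sub>e (p - 1) = g x powr\<^sub>e p"
      unfolding enn_powr_add[symmetric] by simp
    also have "2 powr\<^sub>e (p - 1) = ennreal (2 powr (p - 1))"
      using enn_powr_ennreal[of 2 "p - 1"] by simp
    also have "4 * (ennreal (2 powr (p - 1)) / ennreal (p - 1)) = ennreal (4 * 2 powr (p - 1) / (p - 1))"
      using p by (simp add: divide_ennreal ennreal_mult'[of 4, simplified, symmetric])
    finally show "(\<integral>\<^sup>+l. 4 * (g x * (ennreal (l powr (p - 2)) * indicator {l. 0 < l \<and> ennreal l < 2 * g x} l)) \<partial>lborel)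
      = ennreal (4 * 2 powr (p - 1) / (p - 1)) * g x powr\<^sub>e p" .
  qed
  also have "ennreal p * \<dots> = ennreal p * (ennreal (4 * 2 powr (p - 1) / (p - 1)) * (\<integral>\<^sup>+x. g x powr\<^sub>e p \<partial>\<mu>))"
    by (subst nn_integral_cmult) auto
  also have "\<dots> = ennreal (p * 4 * 2 powr (p - 1) / (p - 1)) * (\<integral>\<^sup>+x. g x powr\<^sub>e p \<partial>\<mu>)"
    using p by (simp add: mult.assoc[symmetric] ennreal_mult[symmetric])
  finally show ?thesis by (simp add: mult_left_mono)
qed

end

section \<open>Factored Muckenhoupt weights\<close>

text \<open>
  Muckenhoupt's class \<open>A\<^sub>1\<close> with constant \<open>c\<close>.  Weights are real-valued and positive everywhere, which makes
  arbitrary real powers of them harmless; the \<open>A\<^sub>1\<close> condition itself is only imposed almost everywhere, so that a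
  weight may be altered on a null set.
\<close>

definition A1 :: "real \<Rightarrow> (real \<Rightarrow> real) \<Rightarrow> bool" where
  "A1 c a \<longleftrightarrow> a \<in> borel_measurable borel \<and> (\<forall>x. 0 < a x) \<and>
     (AE x in lborel. wmax lborel (\<lambda>y. ennreal (a y)) x \<le> ennreal (c * a x))"

text \<open>
  The \<open>A\<^sub>1\<^sub>+\<^sub>d\<close> weight \<open>a\<^sup>-\<^sup>d b\<close>, for \<open>A\<^sub>1\<close> weights \<open>a\<close> and \<open>b\<close>.  The parameter \<open>d = p - 1\<close> is
  convenient because the conjugate exponent of \<open>1 + d\<close> is \<open>1 + 1/d\<close>.
\<close>

definition factored_weight :: "real \<Rightarrow> (real \<Rightarrow> real) \<Rightarrow> (real \<Rightarrow> real) \<Rightarrow> real \<Rightarrow> real" where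
  "factored_weight d a b x = a x powr (- d) * b x"

lemma A1_measurable [measurable_dest]: "A1 c a \<Longrightarrow> a \<in> borel_measurable borel"
  by (simp add: A1_def)

lemma A1_pos: "A1 c a \<Longrightarrow> 0 < a x"
  by (simp add: A1_def)

lemma A1_mono: "A1 c a \<Longrightarrow> c \<le> c' \<Longrightarrow> A1 c' a"
  by (auto simp: A1_def less_imp_le elim!: eventually_mono intro!: ennreal_leI mult_right_mono
      intro: order_trans)

lemma A1_one: "A1 1 (\<lambda>x. 1)"
proof -
  have "wmax lborel (\<lambda>y. ennreal 1) x \<le> 1" for x
    unfolding wmax_def
    by (intro SUP_least) (auto simp: rat_ivls_def divide_ennreal)
  then show ?thesis by (simp add: A1_def)
qed

lemma factored_weight_measurable [measurable]:
  assumes "a \<in> borel_measurable borel" "b \<in> borel_measurable borel"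
  shows "factored_weight d a b \<in> borel_measurable borel"
  using assms unfolding factored_weight_def by measurable

lemma factored_weight_pos: "A1 c a \<Longrightarrow> A1 c' b \<Longrightarrow> 0 < factored_weight d a b x"
  using A1_pos[of c a x] A1_pos[of c' b x] by (simp add: factored_weight_def)

text \<open>
  The weight that is dual to \<open>w = a\<^sup>-\<^sup>d b\<close> for the exponent \<open>1 + d\<close>, namely \<open>w\<^sup>-\<^sup>1\<^sup>/\<^sup>d\<close>, is again factored: the
  two factors exchange their roles.
\<close>

lemma factored_weight_dual:
  assumes "A1 c a" "A1 c' b" "0 < d"
  shows "factored_weight (1 / d) b a x = factored_weight d a b x powr (- 1 / d)"
  using A1_pos[OF assms(1), of x] A1_pos[OF assms(2), of x] assms(3)
  by (simp add: factored_weight_def powr_mult powr_powr mult.commute)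

interpretation lborel_ivl: ivl_measure "lborel :: real measure"
  by standard (auto simp: rat_ivls_def intro!: emeasure_bounded_finite[unfolded infinity_ennreal_def])

text \<open>
  The averaged form of the \<open>A\<^sub>1\<close> condition.  The average \<open>\<alpha>\<close> over an interval is finite because it is bounded
  by \<open>c a(x)\<close> at some point, and positive because \<open>a\<close> is.
\<close>

lemma A1_average:
  assumes a: "A1 c a" and I: "I \<in> rat_ivls" "I \<noteq> {}"
  obtains \<alpha> where "0 < \<alpha>" "(\<integral>\<^sup>+y\<in>I. ennreal (a y) \<partial>lborel) = ennreal \<alpha> * emeasure lborel I"
    "AE x in lborel. x \<in> I \<longrightarrow> \<alpha> \<le> c * a x"
proof -
  note [measurable] = A1_measurable[OF a] rat_ivls_borel[OF I(1)]
  let ?A = "(\<integral>\<^sup>+y\<in>I. ennreal (a y) \<partial>lborel)"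
  have Ipos: "0 < emeasure lborel I" "emeasure lborel I < top"
    using lborel_ivl.fin_ivl lborel_ivl.pos_ivl I by auto
  have ae: "AE x in lborel. x \<in> I \<longrightarrow> ?A / emeasure lborel I \<le> ennreal (c * a x)"
  proof -
    have "AE x in lborel. wmax lborel (\<lambda>y. ennreal (a y)) x \<le> ennreal (c * a x)"
      using a by (simp add: A1_def)
    then show ?thesis
    proof (rule eventually_mono, intro impI)
      fix x assume "wmax lborel (\<lambda>y. ennreal (a y)) x \<le> ennreal (c * a x)" "x \<in> I"
      moreover have "?A / emeasure lborel I \<le> wmax lborel (\<lambda>y. ennreal (a y)) x"
        unfolding wmax_def using I(1) \<open>x \<in> I\<close> by (intro SUP_upper) auto
      ultimately show "?A / emeasure lborel I \<le> ennreal (c * a x)" by simp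
    qed
  qed
  have "\<exists>x\<in>I. ?A / emeasure lborel I \<le> ennreal (c * a x)"
  proof (rule ccontr)
    assume "\<not> ?thesis"
    with ae have "AE x in lborel. x \<notin> I" by (auto elim!: eventually_mono)
    then have "emeasure lborel I = 0" by (simp add: AE_iff_measurable[OF _ refl] )
    with Ipos show False by simp
  qed
  then have "?A / emeasure lborel I < top"
    using ennreal_less_top le_less_trans by blast
  moreover have "?A \<noteq> 0"
  proof
    assume "?A = 0"
    then have "AE x in lborel. ennreal (a x) * indicator I x = 0"
      by (subst (asm) nn_integral_0_iff_AE) auto
    then have "AE x in lborel. x \<notin> I"
    proof eventually_elim
      case (elim x)
      with A1_pos[OF a, of x] show ?case
        by (auto simp: indicator_def ennreal_eq_0_iff not_le split: if_splits)
    qed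
    then have "emeasure lborel I = 0" by (simp add: AE_iff_measurable[OF _ refl] )
    with Ipos show False by simp
  qed
  then have "?A / emeasure lborel I \<noteq> 0" using Ipos by simp
  ultimately obtain \<alpha> where \<alpha>: "0 < \<alpha>" "?A / emeasure lborel I = ennreal \<alpha>"
    by (cases "?A / emeasure lborel I") (auto simp: less_le)
  show ?thesis
  proof
    show "?A = ennreal \<alpha> * emeasure lborel I"
      unfolding \<alpha>(2)[symmetric] using Ipos by (simp add: ennreal_divide_times)
    show "AE x in lborel. x \<in> I \<longrightarrow> \<alpha> \<le> c * a x"
      using ae
    proof (rule eventually_mono, intro impI)
      fix x assume "x \<in> I \<longrightarrow> ?A / emeasure lborel I \<le> ennreal (c * a x)" "x \<in> I"
      then have "ennreal \<alpha> \<le> ennreal (c * a x)" by (simp add: \<alpha>)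
      then show "\<alpha> \<le> c * a x" using \<alpha>(1) by (auto simp: ennreal_le_iff2)
    qed
  qed fact
qed

text \<open>
  On an interval where \<open>a\<close> has average \<open>\<alpha>\<close>, the \<open>A\<^sub>1\<close> condition gives \<open>a \<ge> \<alpha>/c\<close>, so the negative power
  of \<open>a\<close> may be replaced by a constant.
\<close>

lemma factored_weight_integral_le:
  assumes a: "A1 c a" and b: "A1 c' b" and d: "0 \<le> d" and c: "0 < c"
    and I: "I \<in> rat_ivls" "I \<noteq> {}"
    and \<alpha>: "0 < \<alpha>" "AE x in lborel. x \<in> I \<longrightarrow> \<alpha> \<le> c * a x"
    and \<beta>: "(\<integral>\<^sup>+y\<in>I. ennreal (b y) \<partial>lborel) = ennreal \<beta> * emeasure lborel I"
  shows "(\<integral>\<^sup>+y\<in>I. ennreal (factored_weight d a b y) \<partial>lborel)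
    \<le> ennreal ((\<alpha> / c) powr (- d)) * ennreal \<beta> * emeasure lborel I"
proof -
  note [measurable] = A1_measurable[OF a] A1_measurable[OF b] rat_ivls_borel[OF I(1)]
  have "(\<integral>\<^sup>+y\<in>I. ennreal (factored_weight d a b y) \<partial>lborel)
    \<le> (\<integral>\<^sup>+y. ennreal ((\<alpha> / c) powr (- d)) * (ennreal (b y) * indicator I y) \<partial>lborel)"
  proof (rule nn_integral_mono_AE, rule eventually_mono[OF \<alpha>(2)])
    fix x assume x: "x \<in> I \<longrightarrow> \<alpha> \<le> c * a x"
    show "ennreal (factored_weight d a b x) * indicator I x
      \<le> ennreal ((\<alpha> / c) powr (- d)) * (ennreal (b x) * indicator I x)"
    proof (cases "x \<in> I")
      case True
      then have "\<alpha> / c \<le> a x" using x c by (simp add: field_simps)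
      then have "a x powr (- d) \<le> (\<alpha> / c) powr (- d)"
        using \<alpha>(1) c d by (intro powr_mono2') auto
      then have "factored_weight d a b x \<le> (\<alpha> / c) powr (- d) * b x"
        unfolding factored_weight_def using A1_pos[OF b, of x] by (intro mult_right_mono) auto
      then show ?thesis using True A1_pos[OF b, of x]
        by (simp add: ennreal_mult[symmetric] ennreal_leI)
    qed simp
  qed
  also have "\<dots> = ennreal ((\<alpha> / c) powr (- d)) * (\<integral>\<^sup>+y\<in>I. ennreal (b y) \<partial>lborel)"
    by (rule nn_integral_cmult) measurable
  finally show ?thesis unfolding \<beta> by (simp add: mult.assoc)
qed

lemma ivl_measure_factored_weight:
  assumes a: "A1 c a" and b: "A1 c b" and d: "0 \<le> d" and c: "0 < c"
  shows "ivl_measure (density lborel (\<lambda>x. ennreal (factored_weight d a b x)))"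
proof
  note [measurable] = A1_measurable[OF a] A1_measurable[OF b]
  show "sets (density lborel (\<lambda>x. ennreal (factored_weight d a b x))) = sets borel" by simp
  fix I assume I: "I \<in> rat_ivls"
  note [measurable] = rat_ivls_borel[OF I]
  have em: "emeasure (density lborel (\<lambda>x. ennreal (factored_weight d a b x))) I
    = (\<integral>\<^sup>+y\<in>I. ennreal (factored_weight d a b y) \<partial>lborel)"
    by (rule emeasure_density) auto
  show "emeasure (density lborel (\<lambda>x. ennreal (factored_weight d a b x))) I < top"
  proof (cases "I = {}")
    case False
    obtain \<alpha> where \<alpha>: "0 < \<alpha>" "AE x in lborel. x \<in> I \<longrightarrow> \<alpha> \<le> c * a x"
      using A1_average[OF a I False] by metis
    obtain \<beta> where \<beta>: "(\<integral>\<^sup>+y\<in>I. ennreal (b y) \<partial>lborel) = ennreal \<beta> * emeasure lborel I"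
      using A1_average[OF b I False] by metis
    show ?thesis unfolding em
      by (rule le_less_trans[OF factored_weight_integral_le[OF a b d c I False \<alpha> \<beta>]])
        (auto simp: ennreal_mult_less_top intro: lborel_ivl.fin_ivl[OF I])
  qed simp
  assume "I \<noteq> {}"
  show "0 < emeasure (density lborel (\<lambda>x. ennreal (factored_weight d a b x))) I"
  proof (rule ccontr)
    assume "\<not> ?thesis"
    then have "AE x in lborel. ennreal (factored_weight d a b x) * indicator I x = 0"
      unfolding em by (simp add: nn_integral_0_iff_AE)
    then have "AE x in lborel. x \<notin> I"
    proof eventually_elim
      case (elim x)
      with factored_weight_pos[OF a b, of d x] show ?case
        by (auto simp: indicator_def ennreal_eq_0_iff not_le split: if_splits)
    qed
    then have "emeasure lborel I = 0" by (simp add: AE_iff_measurable[OF _ refl])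
    with lborel_ivl.pos_ivl[OF I \<open>I \<noteq> {}\<close>] show False by simp
  qed
qed

lemma wmax_upper:
  "I \<in> rat_ivls \<Longrightarrow> x \<in> I \<Longrightarrow> (\<integral>\<^sup>+y\<in>I. g y \<partial>\<mu>) / emeasure \<mu> I \<le> wmax \<mu> g x"
  unfolding wmax_def by (intro SUP_upper) auto

lemma (in ivl_measure) wmax_upper':
  assumes I: "I \<in> rat_ivls" and x: "x \<in> I"
  shows "(\<integral>\<^sup>+y\<in>I. g y \<partial>\<mu>) \<le> wmax \<mu> g x * emeasure \<mu> I"
proof -
  have "0 < emeasure \<mu> I" "emeasure \<mu> I < top" using pos_ivl[OF I] fin_ivl[OF I] x by auto
  then have "(\<integral>\<^sup>+y\<in>I. g y \<partial>\<mu>) = (\<integral>\<^sup>+y\<in>I. g y \<partial>\<mu>) / emeasure \<mu> I * emeasure \<mu> I"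
    by (simp add: ennreal_divide_times)
  also have "\<dots> \<le> wmax \<mu> g x * emeasure \<mu> I"
    by (intro mult_right_mono wmax_upper I x) auto
  finally show ?thesis .
qed

text \<open>
  Lerner's pointwise estimate.  Let \<open>w\<close> be the weight, \<open>\<sigma>\<close> its dual and \<open>m = M\<^sub>\<sigma>(g/\<sigma>)\<close>.  The average
  of \<open>g/\<sigma>\<close> over an interval \<open>I\<close> with respect to \<open>\<sigma>\<close> is at most \<open>m\<close> at every point of \<open>I\<close>; integrating
  the \<open>d\<close>-th power of this over \<open>I\<close> bounds the \<open>d\<close>-th power of the average of \<open>g\<close> by
  \<open>M\<^sub>w(m\<^sup>d/w)\<close>, up to the factor \<open>w(I)/\<bar>I\<bar> (\<sigma>(I)/\<bar>I\<bar>)\<^sup>d\<close>.  For a factored weight the averages of \<open>a\<close> and \<open>b\<close> cancel in that factor and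
  leave \<open>c\<^sup>1\<^sup>+\<^sup>d\<close>.
\<close>

lemma lerner_pointwise:
  assumes a: "A1 c a" and b: "A1 c b" and d: "0 < d" and c: "0 < c"
    and [measurable]: "g \<in> borel_measurable borel"
  defines "\<sigma> \<equiv> density lborel (\<lambda>x. ennreal (factored_weight (1 / d) b a x))"
    and "\<mu> \<equiv> density lborel (\<lambda>x. ennreal (factored_weight d a b x))"
  defines "m \<equiv> wmax \<sigma> (\<lambda>x. g x * ennreal (1 / factored_weight (1 / d) b a x))"
  shows "wmax lborel g x powr\<^sub>e d
    \<le> ennreal (c powr (1 + d)) * wmax \<mu> (\<lambda>x. m x powr\<^sub>e d * ennreal (1 / factored_weight d a b x)) x"
proof -
  note [measurable] = A1_measurable[OF a] A1_measurable[OF b]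
  let ?w = "factored_weight d a b" and ?v = "factored_weight (1 / d) b a"
  let ?P = "wmax \<mu> (\<lambda>x. m x powr\<^sub>e d * ennreal (1 / ?w x)) x"
  have [measurable]: "m \<in> borel_measurable borel" unfolding m_def by measurable
  interpret s: ivl_measure \<sigma>
    unfolding \<sigma>_def using ivl_measure_factored_weight[OF b a _ c] d by simp
  interpret m: ivl_measure \<mu>
    unfolding \<mu>_def using ivl_measure_factored_weight[OF a b _ c] d by simp
  have "((\<integral>\<^sup>+y\<in>I. g y \<partial>lborel) / emeasure lborel I) powr\<^sub>e d \<le> ennreal (c powr (1 + d)) * ?P"
    if I: "I \<in> rat_ivls" and x: "x \<in> I" for I
  proof -
    note [measurable] = rat_ivls_borel[OF I]
    have ne: "I \<noteq> {}" using x by auto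
    obtain \<alpha> where \<alpha>: "0 < \<alpha>" "(\<integral>\<^sup>+y\<in>I. ennreal (a y) \<partial>lborel) = ennreal \<alpha> * emeasure lborel I"
        "AE x in lborel. x \<in> I \<longrightarrow> \<alpha> \<le> c * a x"
      using A1_average[OF a I ne] by metis
    obtain \<beta> where \<beta>: "0 < \<beta>" "(\<integral>\<^sup>+y\<in>I. ennreal (b y) \<partial>lborel) = ennreal \<beta> * emeasure lborel I"
        "AE x in lborel. x \<in> I \<longrightarrow> \<beta> \<le> c * b x"
      using A1_average[OF b I ne] by metis
    define L where "L = emeasure lborel I"
    have L: "0 < L" "L < top"
      using lborel_ivl.fin_ivl[OF I] lborel_ivl.pos_ivl[OF I ne] by (auto simp: L_def)
    define S where "S = emeasure \<sigma> I"
    define W where "W = emeasure \<mu> I"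
    define A where "A = (\<integral>\<^sup>+y\<in>I. g y \<partial>lborel)"
    have S: "0 < S" "S < top" using s.fin_ivl[OF I] s.pos_ivl[OF I ne] by (auto simp: S_def)
    have Sle: "S \<le> ennreal ((\<beta> / c) powr (- 1 / d) * \<alpha>) * L"
      unfolding S_def L_def \<sigma>_def
      using factored_weight_integral_le[OF b a _ c I ne \<beta>(1,3) \<alpha>(2), of "1/d"] \<alpha>(1) d
      by (simp add: emeasure_density ennreal_mult)
    have Wle: "W \<le> ennreal ((\<alpha> / c) powr (- d) * \<beta>) * L"
      unfolding W_def L_def \<mu>_def
      using factored_weight_integral_le[OF a b _ c I ne \<alpha>(1,3) \<beta>(2), of d] \<beta>(1) d
      by (simp add: emeasure_density ennreal_mult)
    have A_eq: "A = (\<integral>\<^sup>+y\<in>I. g y * ennreal (1 / ?v y) \<partial>\<sigma>)"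
    proof -
      have "(\<integral>\<^sup>+y\<in>I. g y * ennreal (1 / ?v y) \<partial>\<sigma>)
        = (\<integral>\<^sup>+y. ennreal (?v y) * (g y * ennreal (1 / ?v y) * indicator I y) \<partial>lborel)"
        unfolding \<sigma>_def by (rule nn_integral_density) measurable
      also have "\<dots> = A" unfolding A_def
      proof (rule nn_integral_cong)
        fix y
        have "ennreal (?v y) * ennreal (1 / ?v y) = 1"
          using factored_weight_pos[OF b a, of "1/d" y] by (simp add: ennreal_mult[symmetric])
        then show "ennreal (?v y) * (g y * ennreal (1 / ?v y) * indicator I y) = g y * indicator I y"
          by (metis mult.assoc mult.commute mult_1)
      qed
      finally show ?thesis by simp
    qed
    have mge: "A / S \<le> m y" if "y \<in> I" for y
      unfolding A_eq S_def m_def using I that by (rule wmax_upper)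
    have "(A / S) powr\<^sub>e d * L = (\<integral>\<^sup>+y. (A / S) powr\<^sub>e d * indicator I y \<partial>lborel)"
      unfolding L_def by (simp add: nn_integral_cmult_indicator)
    also have "\<dots> \<le> (\<integral>\<^sup>+y. m y powr\<^sub>e d * indicator I y \<partial>lborel)"
      using mge d by (intro nn_integral_mono) (auto simp: indicator_def intro!: enn_powr_mono)
    also have "\<dots> = (\<integral>\<^sup>+y. ennreal (?w y) * (m y powr\<^sub>e d * ennreal (1 / ?w y) * indicator I y) \<partial>lborel)"
    proof (rule nn_integral_cong)
      fix y
      have "ennreal (?w y) * ennreal (1 / ?w y) = 1"
        using factored_weight_pos[OF a b, of d y] by (simp add: ennreal_mult[symmetric])
      then show "m y powr\<^sub>e d * indicator I y
          = ennreal (?w y) * (m y powr\<^sub>e d * ennreal (1 / ?w y) * indicator I y)"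
        by (metis mult.assoc mult.commute mult_1)
    qed
    also have "\<dots> = (\<integral>\<^sup>+y\<in>I. m y powr\<^sub>e d * ennreal (1 / ?w y) \<partial>\<mu>)"
      unfolding \<mu>_def by (rule nn_integral_density[symmetric]) measurable
    also have "\<dots> \<le> ?P * W"
      unfolding W_def using I x by (rule m.wmax_upper')
    also have "\<dots> \<le> ?P * (ennreal ((\<alpha> / c) powr (- d) * \<beta>) * L)"
      by (intro mult_left_mono Wle) auto
    finally have "(A / S) powr\<^sub>e d * L \<le> ?P * ennreal ((\<alpha> / c) powr (- d) * \<beta>) * L"
      by (simp add: mult.assoc)
    then have 1: "(A / S) powr\<^sub>e d \<le> ?P * ennreal ((\<alpha> / c) powr (- d) * \<beta>)"
      using L by (auto simp: ennreal_mult_le_mult_iff mult.commute[of _ L])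
    have "A / L = A / S * (S / L)"
      using S by (simp add: ennreal_times_divide ennreal_divide_times)
    also have "\<dots> \<le> A / S * ennreal ((\<beta> / c) powr (- 1 / d) * \<alpha>)"
      using L Sle by (intro mult_left_mono divide_le_posI_ennreal) (auto simp: mult.commute)
    finally have "(A / L) powr\<^sub>e d \<le> (A / S * ennreal ((\<beta> / c) powr (- 1 / d) * \<alpha>)) powr\<^sub>e d"
      using d by (intro enn_powr_mono) auto
    also have "\<dots> = (A / S) powr\<^sub>e d * ennreal (((\<beta> / c) powr (- 1 / d) * \<alpha>) powr d)"
      using d \<alpha> by (simp add: enn_powr_mult enn_powr_ennreal)
    also have "\<dots> \<le> ?P * ennreal ((\<alpha> / c) powr (- d) * \<beta>) * ennreal (((\<beta> / c) powr (- 1 / d) * \<alpha>) powr d)"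
      by (intro mult_right_mono 1) auto
    also have "\<dots> = ?P * ennreal ((\<alpha> / c) powr (- d) * \<beta> * ((\<beta> / c) powr (- 1 / d) * \<alpha>) powr d)"
      using \<beta> by (simp add: ennreal_mult mult.assoc)
    also have "(\<alpha> / c) powr (- d) * \<beta> * ((\<beta> / c) powr (- 1 / d) * \<alpha>) powr d = c powr (1 + d)"
      using \<alpha>(1) \<beta>(1) c d
      by (simp add: powr_mult powr_divide powr_powr powr_minus powr_add field_simps)
    finally show ?thesis by (simp add: A_def L_def mult.commute)
  qed
  then show ?thesis
    unfolding wmax_def[of lborel] SUP_enn_powr[OF d] by (intro SUP_least) auto
qed

text \<open>
  Muckenhoupt's theorem for factored weights.  Integrating the power \<open>1 + 1/d\<close> of the pointwise estimate against
  \<open>w\<close>, one applies the strong type estimate for \<open>w\<close> with exponent \<open>1 + 1/d\<close> and the one for \<open>\<sigma>\<close> with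
  exponent \<open>1 + d\<close>; the powers of the weights match because \<open>\<sigma> = w\<^sup>-\<^sup>1\<^sup>/\<^sup>d\<close>.
\<close>

lemma maximal_weighted:
  assumes d: "0 < d" and c: "0 < c"
  shows "\<exists>K>0. \<forall>a b g. A1 c a \<longrightarrow> A1 c b \<longrightarrow> g \<in> borel_measurable borel \<longrightarrow>
    (\<integral>\<^sup>+x. wmax lborel g x powr\<^sub>e (1 + d) * ennreal (factored_weight d a b x) \<partial>lborel)
      \<le> ennreal K * (\<integral>\<^sup>+x. g x powr\<^sub>e (1 + d) * ennreal (factored_weight d a b x) \<partial>lborel)"
proof -
  define st where "st p = p * 4 * 2 powr (p - 1) / (p - 1)" for p :: real
  have st: "0 < st p" if "1 < p" for p using that by (simp add: st_def)
  let ?C = "(c powr (1 + d)) powr (1 + 1 / d)"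
  define K where "K = ?C * st (1 + 1 / d) * st (1 + d)"
  have K: "0 < K" using st[of "1 + 1/d"] st[of "1 + d"] c d by (simp add: K_def)
  have "(\<integral>\<^sup>+x. wmax lborel g x powr\<^sub>e (1 + d) * ennreal (factored_weight d a b x) \<partial>lborel)
      \<le> ennreal K * (\<integral>\<^sup>+x. g x powr\<^sub>e (1 + d) * ennreal (factored_weight d a b x) \<partial>lborel)"
    if a: "A1 c a" and b: "A1 c b" and [measurable]: "g \<in> borel_measurable borel" for a b g
  proof -
    note [measurable] = A1_measurable[OF a] A1_measurable[OF b]
    let ?w = "factored_weight d a b" and ?v = "factored_weight (1 / d) b a"
    define \<sigma> where "\<sigma> = density lborel (\<lambda>x. ennreal (?v x))"
    define \<mu> where "\<mu> = density lborel (\<lambda>x. ennreal (?w x))"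
    define m where "m = wmax \<sigma> (\<lambda>x. g x * ennreal (1 / ?v x))"
    define P where "P = wmax \<mu> (\<lambda>x. m x powr\<^sub>e d * ennreal (1 / ?w x))"
    have [measurable]: "m \<in> borel_measurable borel" "P \<in> borel_measurable borel"
      unfolding m_def P_def by measurable
    interpret s: ivl_measure \<sigma>
      unfolding \<sigma>_def using ivl_measure_factored_weight[OF b a _ c] d by simp
    interpret m: ivl_measure \<mu>
      unfolding \<mu>_def using ivl_measure_factored_weight[OF a b _ c] d by simp
    have dd: "d * (1 + 1 / d) = 1 + d" using d by (simp add: distrib_left)
    have pw: "wmax lborel g x powr\<^sub>e (1 + d) \<le> ennreal ?C * P x powr\<^sub>e (1 + 1 / d)" for x
    proof -
      have "wmax lborel g x powr\<^sub>e (1 + d) = (wmax lborel g x powr\<^sub>e d) powr\<^sub>e (1 + 1 / d)"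
        by (simp add: enn_powr_powr dd)
      also have "\<dots> \<le> (ennreal (c powr (1 + d)) * P x) powr\<^sub>e (1 + 1 / d)"
        using lerner_pointwise[OF a b d c, of g x] d
        by (intro enn_powr_mono) (auto simp: P_def m_def \<sigma>_def \<mu>_def)
      also have "\<dots> = ennreal ?C * P x powr\<^sub>e (1 + 1 / d)"
        using d c by (simp add: enn_powr_mult enn_powr_ennreal add_pos_pos)
      finally show ?thesis .
    qed
    have wv: "?v x = ?w x powr (- 1 / d)" for x by (rule factored_weight_dual[OF a b d])
    have wp: "0 < ?w x" for x by (rule factored_weight_pos[OF a b])
    have "(\<integral>\<^sup>+x. wmax lborel g x powr\<^sub>e (1 + d) * ennreal (?w x) \<partial>lborel)
      \<le> (\<integral>\<^sup>+x. ennreal ?C * P x powr\<^sub>e (1 + 1 / d) * ennreal (?w x) \<partial>lborel)"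
      by (intro nn_integral_mono mult_right_mono pw) auto
    also have "\<dots> = ennreal ?C * (\<integral>\<^sup>+x. ennreal (?w x) * P x powr\<^sub>e (1 + 1 / d) \<partial>lborel)"
      by (subst nn_integral_cmult[symmetric]) (auto simp: mult_ac)
    also have "(\<integral>\<^sup>+x. ennreal (?w x) * P x powr\<^sub>e (1 + 1 / d) \<partial>lborel) = (\<integral>\<^sup>+x. P x powr\<^sub>e (1 + 1 / d) \<partial>\<mu>)"
      unfolding \<mu>_def by (rule nn_integral_density[symmetric]) measurable
    also have "\<dots> \<le> ennreal (st (1 + 1 / d)) *
        (\<integral>\<^sup>+x. (m x powr\<^sub>e d * ennreal (1 / ?w x)) powr\<^sub>e (1 + 1 / d) \<partial>\<mu>)"
      unfolding P_def st_def using d by (intro m.strong_type) auto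
    also have "(\<integral>\<^sup>+x. (m x powr\<^sub>e d * ennreal (1 / ?w x)) powr\<^sub>e (1 + 1 / d) \<partial>\<mu>)
      = (\<integral>\<^sup>+x. ennreal (?w x) * (m x powr\<^sub>e d * ennreal (1 / ?w x)) powr\<^sub>e (1 + 1 / d) \<partial>lborel)"
      unfolding \<mu>_def by (rule nn_integral_density) measurable
    also have "\<dots> = (\<integral>\<^sup>+x. ennreal (?v x) * m x powr\<^sub>e (1 + d) \<partial>lborel)"
    proof (rule nn_integral_cong)
      fix x
      have "(1 / ?w x) powr (1 + 1 / d) = ?w x powr (- (1 + 1 / d))"
        using wp[of x] by (simp only: powr_minus_divide powr_divide) simp
      then have e: "?w x * (1 / ?w x) powr (1 + 1 / d) = ?v x"
        unfolding wv using wp[of x] by (simp add: powr_mult_base)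
      have "ennreal (?w x) * (m x powr\<^sub>e d * ennreal (1 / ?w x)) powr\<^sub>e (1 + 1 / d)
        = (ennreal (?w x) * ennreal ((1 / ?w x) powr (1 + 1 / d))) * (m x powr\<^sub>e d) powr\<^sub>e (1 + 1 / d)"
        using d wp[of x] by (simp add: enn_powr_mult add_pos_pos enn_powr_ennreal mult_ac)
      also have "ennreal (?w x) * ennreal ((1 / ?w x) powr (1 + 1 / d)) = ennreal (?v x)"
        using wp[of x] by (simp add: ennreal_mult[symmetric] e)
      also have "(m x powr\<^sub>e d) powr\<^sub>e (1 + 1 / d) = m x powr\<^sub>e (1 + d)"
        by (simp add: enn_powr_powr dd)
      finally show "ennreal (?w x) * (m x powr\<^sub>e d * ennreal (1 / ?w x)) powr\<^sub>e (1 + 1 / d)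
        = ennreal (?v x) * m x powr\<^sub>e (1 + d)" .
    qed
    also have "\<dots> = (\<integral>\<^sup>+x. m x powr\<^sub>e (1 + d) \<partial>\<sigma>)"
      unfolding \<sigma>_def by (rule nn_integral_density[symmetric]) measurable
    also have "\<dots> \<le> ennreal (st (1 + d)) * (\<integral>\<^sup>+x. (g x * ennreal (1 / ?v x)) powr\<^sub>e (1 + d) \<partial>\<sigma>)"
      unfolding m_def st_def using d by (intro s.strong_type) auto
    also have "(\<integral>\<^sup>+x. (g x * ennreal (1 / ?v x)) powr\<^sub>e (1 + d) \<partial>\<sigma>)
      = (\<integral>\<^sup>+x. ennreal (?v x) * (g x * ennreal (1 / ?v x)) powr\<^sub>e (1 + d) \<partial>lborel)"
      unfolding \<sigma>_def by (rule nn_integral_density) measurable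
    also have "\<dots> = (\<integral>\<^sup>+x. g x powr\<^sub>e (1 + d) * ennreal (?w x) \<partial>lborel)"
    proof (rule nn_integral_cong)
      fix x
      have vp: "0 < ?v x" by (rule factored_weight_pos[OF b a])
      have e: "?v x * (1 / ?v x) powr (1 + d) = ?w x"
        unfolding wv using wp[of x] d by (simp add: powr_divide powr_add powr_minus powr_powr field_simps)
      have "ennreal (?v x) * (g x * ennreal (1 / ?v x)) powr\<^sub>e (1 + d)
        = g x powr\<^sub>e (1 + d) * (ennreal (?v x) * ennreal ((1 / ?v x) powr (1 + d)))"
        using d vp by (simp add: enn_powr_mult enn_powr_ennreal mult_ac)
      also have "ennreal (?v x) * ennreal ((1 / ?v x) powr (1 + d)) = ennreal (?w x)"
        using vp by (simp add: ennreal_mult[symmetric] e)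
      finally show "ennreal (?v x) * (g x * ennreal (1 / ?v x)) powr\<^sub>e (1 + d)
        = g x powr\<^sub>e (1 + d) * ennreal (?w x)" .
    qed
    finally have "(\<integral>\<^sup>+x. wmax lborel g x powr\<^sub>e (1 + d) * ennreal (?w x) \<partial>lborel)
      \<le> ennreal ?C * (ennreal (st (1 + 1 / d)) * (ennreal (st (1 + d)) *
          (\<integral>\<^sup>+x. g x powr\<^sub>e (1 + d) * ennreal (?w x) \<partial>lborel)))"
      by (simp add: mult_left_mono)
    also have "\<dots> = ennreal K * (\<integral>\<^sup>+x. g x powr\<^sub>e (1 + d) * ennreal (?w x) \<partial>lborel)"
      using st[of "1 + 1 / d"] st[of "1 + d"] d
      by (simp add: K_def ennreal_mult mult.assoc)
    finally show ?thesis .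
  qed
  with K show ?thesis by blast
qed

section \<open>Rubio de Francia extrapolation\<close>

lemma wmax_mono: "(\<And>y. g y \<le> h y) \<Longrightarrow> wmax \<mu> g x \<le> wmax \<mu> h x"
  unfolding wmax_def
  by (intro SUP_mono' divide_right_mono_ennreal nn_integral_mono mult_right_mono) auto

lemma wmax_cong_AE:
  assumes "AE y in \<mu>. g y = h y"
  shows "wmax \<mu> g x = wmax \<mu> h x"
  unfolding wmax_def
  by (intro SUP_cong refl arg_cong2[where f = "(/)"] nn_integral_cong_AE eventually_mono[OF assms]) auto

lemma wmax_cmult:
  assumes [measurable_cong]: "sets \<mu> = sets borel" and [measurable]: "g \<in> borel_measurable borel"
  shows "wmax \<mu> (\<lambda>y. r * g y) x = r * wmax \<mu> g x"
proof -
  have "(\<integral>\<^sup>+y\<in>I. r * g y \<partial>\<mu>) / emeasure \<mu> I = r * ((\<integral>\<^sup>+y\<in>I. g y \<partial>\<mu>) / emeasure \<mu> I)"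
    if "I \<in> rat_ivls" for I
  proof -
    note [measurable] = rat_ivls_borel[OF that]
    have "(\<integral>\<^sup>+y\<in>I. r * g y \<partial>\<mu>) = r * (\<integral>\<^sup>+y\<in>I. g y \<partial>\<mu>)"
      unfolding mult.assoc by (rule nn_integral_cmult) measurable
    then show ?thesis by (simp add: ennreal_times_divide)
  qed
  then show ?thesis
    unfolding wmax_def by (simp add: SUP_mult_left_ennreal)
qed

lemma wmax_suminf:
  assumes [measurable_cong]: "sets \<mu> = sets borel" and [measurable]: "\<And>n. g n \<in> borel_measurable borel"
  shows "wmax \<mu> (\<lambda>y. \<Sum>n. g n y) x \<le> (\<Sum>n. wmax \<mu> (g n) x)"
  unfolding wmax_def[of \<mu> "\<lambda>y. \<Sum>n. g n y"]
proof (intro SUP_least)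
  fix I assume "I \<in> {I \<in> rat_ivls. x \<in> I}"
  then have I: "I \<in> rat_ivls" "x \<in> I" by auto
  note [measurable] = rat_ivls_borel[OF I(1)]
  have "(\<integral>\<^sup>+y\<in>I. (\<Sum>n. g n y) \<partial>\<mu>) = (\<integral>\<^sup>+y. (\<Sum>n. g n y * indicator I y) \<partial>\<mu>)" by simp
  also have "\<dots> = (\<Sum>n. \<integral>\<^sup>+y\<in>I. g n y \<partial>\<mu>)"
    by (rule nn_integral_suminf) measurable
  also have "\<dots> / emeasure \<mu> I = (\<Sum>n. (\<integral>\<^sup>+y\<in>I. g n y \<partial>\<mu>) / emeasure \<mu> I)" by simp
  also have "\<dots> \<le> (\<Sum>n. wmax \<mu> (g n) x)"
    by (intro suminf_le wmax_upper I) auto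
  finally show "(\<integral>\<^sup>+y\<in>I. (\<Sum>n. g n y) \<partial>\<mu>) / emeasure \<mu> I \<le> (\<Sum>n. wmax \<mu> (g n) x)" .
qed

text \<open>
  Any two points lie in a common interval, so \<open>Mg\<close> vanishing at a single point forces \<open>g = 0\<close> almost everywhere.
\<close>

lemma wmax_pos:
  assumes [measurable]: "g \<in> borel_measurable borel" and "\<not> (AE x in lborel. g x = 0)"
  shows "0 < wmax lborel g x"
proof (rule ccontr)
  assume "\<not> ?thesis"
  then have z: "wmax lborel g x = 0" by simp
  have "AE y in lborel. \<forall>I\<in>{I\<in>rat_ivls. x \<in> I}. y \<in> I \<longrightarrow> g y = 0"
  proof (rule AE_ball_countable')
    show "countable {I\<in>rat_ivls. x \<in> I}" by (rule countable_subset[OF _ countable_rat_ivls]) auto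
  next
    fix I assume "I \<in> {I\<in>rat_ivls. x \<in> I}"
    then have I: "I \<in> rat_ivls" "x \<in> I" by auto
    note [measurable] = rat_ivls_borel[OF I(1)]
    have "(\<integral>\<^sup>+y\<in>I. g y \<partial>lborel) = 0"
      using lborel_ivl.wmax_upper'[OF I, of g] z by simp
    then have "AE y in lborel. g y * indicator I y = 0"
      by (subst (asm) nn_integral_0_iff_AE) auto
    then show "AE y in lborel. y \<in> I \<longrightarrow> g y = 0"
      by eventually_elim (auto simp: indicator_def split: if_splits)
  qed
  then have "AE y in lborel. g y = 0"
  proof (rule eventually_mono)
    fix y assume *: "\<forall>I\<in>{I\<in>rat_ivls. x \<in> I}. y \<in> I \<longrightarrow> g y = 0"
    have "min x y \<le> max x y" by simp
    then obtain I where I: "I \<in> rat_ivls" "{min x y..max x y} \<subseteq> I"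
      by (rule ex_rat_ivl[OF _ zero_less_one])
    have "x \<in> {min x y..max x y}" "y \<in> {min x y..max x y}" by auto
    with I * show "g y = 0" by blast
  qed
  with assms(2) show False ..
qed

text \<open>
  The Rubio de Francia algorithm: \<open>h\<close> has an \<open>A\<^sub>1\<close> majorant of comparable weighted norm.  It is the
  series \<open>H = \<Sum>\<^sub>n (2\<kappa>)\<^sup>-\<^sup>n M\<^sup>n h\<close>; subadditivity of \<open>M\<close> gives \<open>M H \<le> 2\<kappa> H\<close>, and the series
  converges in \<open>L\<^sup>1\<^sup>+\<^sup>d(w)\<close> once \<open>\<kappa>\<close> exceeds the norm of \<open>M\<close> sufficiently.
\<close>

lemma A1_majorant:
  assumes d: "0 < d" and c: "0 < c"
  shows "\<exists>D>0. \<exists>E>0. \<forall>a b h. A1 c a \<longrightarrow> A1 c b \<longrightarrow> h \<in> borel_measurable borel \<longrightarrow>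
     (\<integral>\<^sup>+x. h x powr\<^sub>e (1 + d) * ennreal (factored_weight d a b x) \<partial>lborel) < top \<longrightarrow>
     \<not> (AE x in lborel. h x = 0) \<longrightarrow>
     (\<exists>H. A1 D H \<and> (AE x in lborel. h x \<le> ennreal (H x)) \<and>
        (\<integral>\<^sup>+x. ennreal (H x) powr\<^sub>e (1 + d) * ennreal (factored_weight d a b x) \<partial>lborel)
          \<le> ennreal E * (\<integral>\<^sup>+x. h x powr\<^sub>e (1 + d) * ennreal (factored_weight d a b x) \<partial>lborel))"
proof -
  obtain K where K: "0 < K" and max: "\<And>a b g. A1 c a \<Longrightarrow> A1 c b \<Longrightarrow> g \<in> borel_measurable borel \<Longrightarrow>
    (\<integral>\<^sup>+x. wmax lborel g x powr\<^sub>e (1 + d) * ennreal (factored_weight d a b x) \<partial>lborel)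
      \<le> ennreal K * (\<integral>\<^sup>+x. g x powr\<^sub>e (1 + d) * ennreal (factored_weight d a b x) \<partial>lborel)"
    using maximal_weighted[OF d c] by blast
  \<comment> \<open>With this choice each of the functions \<open>X n = \<kappa>\<^sup>-\<^sup>n M\<^sup>n h\<close> has at most half the weighted integral of its predecessor.\<close>
  define \<kappa> where "\<kappa> = (2 * K) powr (1 / (1 + d))"
  have \<kappa>: "0 < \<kappa>" "(1 / \<kappa>) powr (1 + d) * K = 1 / 2"
    using K d by (simp_all add: \<kappa>_def powr_divide powr_powr)
  let ?E = "2 powr (1 + d) * 2"
  have "\<exists>H. A1 (2 * \<kappa>) H \<and> (AE x in lborel. h x \<le> ennreal (H x)) \<and>
        (\<integral>\<^sup>+x. ennreal (H x) powr\<^sub>e (1 + d) * ennreal (factored_weight d a b x) \<partial>lborel)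
          \<le> ennreal ?E * (\<integral>\<^sup>+x. h x powr\<^sub>e (1 + d) * ennreal (factored_weight d a b x) \<partial>lborel)"
    if a: "A1 c a" and b: "A1 c b" and [measurable]: "h \<in> borel_measurable borel"
      and fin: "(\<integral>\<^sup>+x. h x powr\<^sub>e (1 + d) * ennreal (factored_weight d a b x) \<partial>lborel) < top"
      and nz: "\<not> (AE x in lborel. h x = 0)" for a b h
  proof -
    note [measurable] = A1_measurable[OF a] A1_measurable[OF b]
    let ?w = "factored_weight d a b"
    let ?N = "\<lambda>g. (\<integral>\<^sup>+x. g x powr\<^sub>e (1 + d) * ennreal (?w x) \<partial>lborel)"
    define X where "X n = ((\<lambda>g y. ennreal (1 / \<kappa>) * wmax lborel g y) ^^ n) h" for n
    have X0: "X 0 = h" and XS: "X (Suc n) y = ennreal (1 / \<kappa>) * wmax lborel (X n) y" for n y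
      by (simp_all add: X_def)
    have XSf: "X (Suc n) = (\<lambda>y. ennreal (1 / \<kappa>) * wmax lborel (X n) y)" for n
      using XS by auto
    have [measurable]: "X n \<in> borel_measurable borel" for n
      by (induction n) (auto simp: X0 XSf)
    have NX: "?N (X n) \<le> ennreal ((1 / 2) ^ n) * ?N h" for n
    proof (induction n)
      case (Suc n)
      have "?N (X (Suc n)) = (\<integral>\<^sup>+x. ennreal ((1 / \<kappa>) powr (1 + d)) * (wmax lborel (X n) x powr\<^sub>e (1 + d) * ennreal (?w x)) \<partial>lborel)"
        unfolding XS using d \<kappa>(1) by (intro nn_integral_cong) (simp add: enn_powr_mult enn_powr_ennreal mult.assoc)
      also have "\<dots> = ennreal ((1 / \<kappa>) powr (1 + d)) * ?N (wmax lborel (X n))"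
        by (rule nn_integral_cmult) measurable
      also have "\<dots> \<le> ennreal ((1 / \<kappa>) powr (1 + d)) * (ennreal K * ?N (X n))"
        by (intro mult_left_mono max a b) auto
      also have "\<dots> = ennreal (1 / 2) * ?N (X n)"
        using K \<kappa>(2) by (simp only: mult.assoc[symmetric] ennreal_mult[symmetric] powr_ge_zero less_imp_le)
      also have "\<dots> \<le> ennreal (1 / 2) * (ennreal ((1 / 2) ^ n) * ?N h)"
        by (intro mult_left_mono Suc) auto
      also have "\<dots> = ennreal ((1 / 2) ^ Suc n) * ?N h"
        by (simp only: power_Suc mult.assoc ennreal_mult zero_le_divide_1_iff zero_le_numeral zero_le_power)
      finally show ?case .
    qed (simp add: X0)
    define H0 where "H0 y = (\<Sum>n. ennreal ((1 / 2) ^ n) * X n y)" for y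
    have [measurable]: "H0 \<in> borel_measurable borel" unfolding H0_def by measurable
    have geom: "(\<Sum>n. ennreal ((1 / 2) ^ n)) = 2"
    proof -
      have "(\<Sum>n. ennreal ((1 / 2) ^ n)) = ennreal (\<Sum>n. (1 / 2) ^ n)"
        by (intro suminf_ennreal2 summable_geometric) auto
      also have "(\<Sum>n. (1 / 2 :: real) ^ n) = 2" by (subst suminf_geometric) auto
      finally show ?thesis by simp
    qed
    have hH0: "h y \<le> H0 y" for y
      using sum_le_suminf[OF summableI, of "{0}" "\<lambda>n. ennreal ((1 / 2) ^ n) * X n y"]
      by (simp add: H0_def X0)
    have MH0: "wmax lborel H0 x \<le> ennreal (2 * \<kappa>) * H0 x" for x
    proof -
      have "wmax lborel H0 x \<le> (\<Sum>n. wmax lborel (\<lambda>y. ennreal ((1 / 2) ^ n) * X n y) x)"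
        unfolding H0_def by (intro wmax_suminf) auto
      also have "\<dots> = (\<Sum>n. ennreal (2 * \<kappa>) * (ennreal ((1 / 2) ^ Suc n) * X (Suc n) x))"
      proof (intro suminf_cong)
        fix n
        have "ennreal (2 * \<kappa>) * (ennreal ((1 / 2) ^ Suc n) * X (Suc n) x)
          = (ennreal (2 * \<kappa>) * ennreal ((1 / 2) ^ Suc n) * ennreal (1 / \<kappa>)) * wmax lborel (X n) x"
          by (simp only: XS mult.assoc)
        also have "ennreal (2 * \<kappa>) * ennreal ((1 / 2) ^ Suc n) * ennreal (1 / \<kappa>) = ennreal ((1 / 2) ^ n)"
          using \<kappa>(1) by (simp add: ennreal_mult[symmetric])
        finally show "wmax lborel (\<lambda>y. ennreal ((1 / 2) ^ n) * X n y) x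
          = ennreal (2 * \<kappa>) * (ennreal ((1 / 2) ^ Suc n) * X (Suc n) x)"
          by (simp add: wmax_cmult)
      qed
      also have "\<dots> = ennreal (2 * \<kappa>) * (\<Sum>n. ennreal ((1 / 2) ^ Suc n) * X (Suc n) x)"
        by simp
      also have "(\<Sum>n. ennreal ((1 / 2) ^ Suc n) * X (Suc n) x) \<le> H0 x"
        unfolding H0_def
        by (subst suminf_offset[of _ "1::nat"]) (simp_all add: add_increasing)
      finally show ?thesis by (simp add: mult_left_mono)
    qed
    have NH0: "?N H0 \<le> ennreal ?E * ?N h"
    proof -
      \<comment> \<open>\<open>H0\<close> is at most twice the supremum of the \<open>X m\<close>, and the power of a supremum is at most the sum of the powers.\<close>
      have pt: "H0 x powr\<^sub>e (1 + d) \<le> ennreal (2 powr (1 + d)) * (\<Sum>n. X n x powr\<^sub>e (1 + d))" for x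
      proof -
        have "H0 x \<le> (\<Sum>n. ennreal ((1 / 2) ^ n) * (SUP m. X m x))"
          unfolding H0_def by (intro suminf_le mult_left_mono SUP_upper) auto
        also have "\<dots> = 2 * (SUP m. X m x)" by (simp only: ennreal_suminf_multc geom)
        finally have "H0 x powr\<^sub>e (1 + d) \<le> (2 * (SUP m. X m x)) powr\<^sub>e (1 + d)"
          using d by (intro enn_powr_mono) auto
        also have "\<dots> = ennreal (2 powr (1 + d)) * (SUP m. X m x powr\<^sub>e (1 + d))"
          using d enn_powr_ennreal[of 2 "1 + d"] by (simp add: enn_powr_mult SUP_enn_powr)
        also have "(SUP m. X m x powr\<^sub>e (1 + d)) \<le> (\<Sum>n. X n x powr\<^sub>e (1 + d))"
        proof (rule SUP_least)
          fix m
          show "X m x powr\<^sub>e (1 + d) \<le> (\<Sum>n. X n x powr\<^sub>e (1 + d))"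
            using sum_le_suminf[OF summableI, of "{m}" "\<lambda>n. X n x powr\<^sub>e (1 + d)"] by simp
        qed
        finally show ?thesis by (simp add: mult_left_mono)
      qed
      have "?N H0 \<le> (\<integral>\<^sup>+x. ennreal (2 powr (1 + d)) * (\<Sum>n. X n x powr\<^sub>e (1 + d)) * ennreal (?w x) \<partial>lborel)"
        by (intro nn_integral_mono mult_right_mono pt) auto
      also have "\<dots> = ennreal (2 powr (1 + d)) * (\<integral>\<^sup>+x. (\<Sum>n. X n x powr\<^sub>e (1 + d) * ennreal (?w x)) \<partial>lborel)"
        by (subst nn_integral_cmult[symmetric]) (auto simp: mult.assoc)
      also have "(\<integral>\<^sup>+x. (\<Sum>n. X n x powr\<^sub>e (1 + d) * ennreal (?w x)) \<partial>lborel) = (\<Sum>n. ?N (X n))"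
        by (rule nn_integral_suminf) measurable
      also have "\<dots> \<le> (\<Sum>n. ennreal ((1 / 2) ^ n) * ?N h)"
        by (intro suminf_le NX) auto
      also have "\<dots> = 2 * ?N h" by (simp only: ennreal_suminf_multc geom)
      finally show ?thesis
        by (simp add: mult_left_mono ennreal_mult mult.assoc)
    qed
    have H0fin: "AE x in lborel. H0 x \<noteq> top"
    proof -
      have "ennreal ?E * ?N h < top" using fin by (simp add: ennreal_mult_less_top)
      then have "?N H0 < top" using NH0 by (rule le_less_trans[rotated])
      then have "AE x in lborel. H0 x powr\<^sub>e (1 + d) * ennreal (?w x) \<noteq> top"
        by (intro nn_integral_noteq_infinite[unfolded infinity_ennreal_def]) auto
      then show ?thesis
      proof eventually_elim
        case (elim x)
        then show ?case using factored_weight_pos[OF a b, of d x]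
          by (auto simp: ennreal_mult_eq_top_iff)
      qed
    qed
    have H0pos: "0 < H0 x" for x
    proof -
      have "\<not> (AE x in lborel. H0 x = 0)"
      proof
        assume "AE x in lborel. H0 x = 0"
        then have "AE x in lborel. h x = 0"
          by eventually_elim (use hH0 in \<open>auto simp: le_zero_eq[symmetric] intro: order_trans simp del: le_zero_eq\<close>)
        with nz show False ..
      qed
      then have "0 < wmax lborel H0 x" by (intro wmax_pos) auto
      also note MH0
      finally show ?thesis by (auto intro: gr_zeroI)
    qed
    \<comment> \<open>\<open>H0\<close> is finite almost everywhere; the value \<open>1\<close> on the remaining null set keeps \<open>H\<close> positive.\<close>
    define H where "H x = (if H0 x = top then 1 else enn2real (H0 x))" for x
    have HH0: "AE x in lborel. ennreal (H x) = H0 x"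
      using H0fin by eventually_elim (simp add: H_def less_top)
    have [measurable]: "H \<in> borel_measurable borel"
    proof -
      have "{x \<in> space borel. H0 x = top} \<in> sets borel"
        using measurable_sets[of H0 borel borel "{top}"] by (simp add: vimage_def)
      then show ?thesis unfolding H_def by (intro measurable_If) auto
    qed
    have "A1 (2 * \<kappa>) H"
      unfolding A1_def
    proof (intro conjI allI)
      show "0 < H x" for x
        using H0pos[of x] by (auto simp: H_def enn2real_positive_iff less_top)
      have Heq: "wmax lborel (\<lambda>y. ennreal (H y)) x = wmax lborel H0 x" for x
        by (rule wmax_cong_AE[OF HH0])
      show "AE x in lborel. wmax lborel (\<lambda>y. ennreal (H y)) x \<le> ennreal (2 * \<kappa> * H x)"
        using HH0
      proof eventually_elim
        case (elim x)
        have "0 \<le> H x" by (simp add: H_def)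
        then show ?case using MH0[of x] elim \<kappa>(1) by (simp add: Heq ennreal_mult)
      qed
    qed fact
    moreover have "AE x in lborel. h x \<le> ennreal (H x)"
      using HH0 by eventually_elim (use hH0 in auto)
    moreover have "(\<integral>\<^sup>+x. ennreal (H x) powr\<^sub>e (1 + d) * ennreal (?w x) \<partial>lborel) = ?N H0"
      by (intro nn_integral_cong_AE eventually_mono[OF HH0]) simp
    then have "(\<integral>\<^sup>+x. ennreal (H x) powr\<^sub>e (1 + d) * ennreal (?w x) \<partial>lborel) \<le> ennreal ?E * ?N h"
      using NH0 by (simp only:)
    ultimately show ?thesis by (intro exI[of _ H] conjI)
  qed
  note majorant = this
  show ?thesis
  proof (rule exI[of _ "2 * \<kappa>"], rule conjI[OF _ exI[of _ ?E]], goal_cases)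
    case 1 show ?case using \<kappa>(1) by simp
  next
    case 2 show ?case using majorant by auto
  qed
qed

text \<open>
  The hypothesis and conclusion of extrapolation.  It concerns a single pair of functions; uniformity over a
  family of pairs is expressed by the control function \<open>N\<close> of the \<open>A\<^sub>1\<close> constant.
\<close>

definition weighted_bound :: "real \<Rightarrow> (real \<Rightarrow> real) \<Rightarrow> (real \<Rightarrow> ennreal) \<Rightarrow> (real \<Rightarrow> ennreal) \<Rightarrow> bool" where
  "weighted_bound r N F G \<longleftrightarrow> F \<in> borel_measurable borel \<and> G \<in> borel_measurable borel \<and>
     (\<forall>c>0. \<forall>a b. A1 c a \<longrightarrow> A1 c b \<longrightarrow>
       (\<integral>\<^sup>+x. F x powr\<^sub>e r * ennreal (factored_weight (r - 1) a b x) \<partial>lborel)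
         \<le> ennreal (N c) * (\<integral>\<^sup>+x. G x powr\<^sub>e r * ennreal (factored_weight (r - 1) a b x) \<partial>lborel))"

lemma weighted_bound_scale:
  assumes W: "weighted_bound r N F G" and r: "0 < r"
  shows "weighted_bound r N (\<lambda>x. k * F x) (\<lambda>x. k * G x)"
proof -
  have [measurable]: "F \<in> borel_measurable borel" "G \<in> borel_measurable borel"
    using W by (auto simp: weighted_bound_def)
  show ?thesis
    unfolding weighted_bound_def
  proof (intro conjI allI impI)
    fix c :: real and a b assume c: "0 < c" and a: "A1 c a" and b: "A1 c b"
    note [measurable] = A1_measurable[OF a] A1_measurable[OF b]
    have sc: "(\<integral>\<^sup>+x. (k * g x) powr\<^sub>e r * ennreal (factored_weight (r - 1) a b x) \<partial>lborel)
      = k powr\<^sub>e r * (\<integral>\<^sup>+x. g x powr\<^sub>e r * ennreal (factored_weight (r - 1) a b x) \<partial>lborel)"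
      if [measurable]: "g \<in> borel_measurable borel" for g
      by (subst nn_integral_cmult[symmetric]) (auto simp: enn_powr_mult r mult.assoc)
    have "k powr\<^sub>e r * (\<integral>\<^sup>+x. F x powr\<^sub>e r * ennreal (factored_weight (r - 1) a b x) \<partial>lborel)
      \<le> k powr\<^sub>e r * (ennreal (N c) * (\<integral>\<^sup>+x. G x powr\<^sub>e r * ennreal (factored_weight (r - 1) a b x) \<partial>lborel))"
      using W c a b by (intro mult_left_mono) (auto simp: weighted_bound_def)
    then show "(\<integral>\<^sup>+x. (k * F x) powr\<^sub>e r * ennreal (factored_weight (r - 1) a b x) \<partial>lborel)
      \<le> ennreal (N c) * (\<integral>\<^sup>+x. (k * G x) powr\<^sub>e r * ennreal (factored_weight (r - 1) a b x) \<partial>lborel)"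
      by (subst (1 2) sc) (auto simp: mult_ac)
  qed auto
qed

lemma weighted_bound_mono:
  assumes W: "weighted_bound r N F G" and r: "0 < r"
    and [measurable]: "F' \<in> borel_measurable borel" and le: "\<And>x. F' x \<le> F x"
  shows "weighted_bound r N F' G"
  unfolding weighted_bound_def
proof (intro conjI allI impI)
  show "G \<in> borel_measurable borel" using W by (simp add: weighted_bound_def)
  fix c :: real and a b assume "0 < c" "A1 c a" "A1 c b"
  then have "(\<integral>\<^sup>+x. F x powr\<^sub>e r * ennreal (factored_weight (r - 1) a b x) \<partial>lborel)
      \<le> ennreal (N c) * (\<integral>\<^sup>+x. G x powr\<^sub>e r * ennreal (factored_weight (r - 1) a b x) \<partial>lborel)"
    using W by (auto simp: weighted_bound_def)
  moreover have "(\<integral>\<^sup>+x. F' x powr\<^sub>e r * ennreal (factored_weight (r - 1) a b x) \<partial>lborel)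
      \<le> (\<integral>\<^sup>+x. F x powr\<^sub>e r * ennreal (factored_weight (r - 1) a b x) \<partial>lborel)"
    using r le by (intro nn_integral_mono mult_right_mono enn_powr_mono) auto
  ultimately show "(\<integral>\<^sup>+x. F' x powr\<^sub>e r * ennreal (factored_weight (r - 1) a b x) \<partial>lborel)
      \<le> ennreal (N c) * (\<integral>\<^sup>+x. G x powr\<^sub>e r * ennreal (factored_weight (r - 1) a b x) \<partial>lborel)"
    by simp
qed auto

text \<open>
  A substitute for Hoelder's inequality: where \<open>f > e H\<close>, the factor \<open>(f/(e H))\<^sup>d\<close> is at least \<open>1\<close>.
\<close>

lemma split_le_weighted_power:
  fixes e d H :: real
  assumes e: "0 < e" and d: "0 < d" and H: "0 < H"
  shows "f \<le> ennreal (e * H) + ennreal (e powr (- d)) * (f powr\<^sub>e (1 + d) * ennreal (H powr (- d)))"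
proof (cases f)
  case (real x)
  show ?thesis
  proof (cases "x \<le> e * H")
    case True
    then show ?thesis using real by (simp add: add_increasing2 ennreal_leI)
  next
    case False
    then have x: "e * H < x" "0 < x" using e H by (auto intro: less_trans[of 0 "e * H"] simp: not_le)
    have "x = x powr (1 + d) * x powr (- d)" using x by (simp add: powr_add[symmetric])
    also have "\<dots> \<le> x powr (1 + d) * (e * H) powr (- d)"
      using x e H d by (intro mult_left_mono powr_mono2') auto
    also have "\<dots> = e powr (- d) * (x powr (1 + d) * H powr (- d))"
      using e H by (simp add: powr_mult mult_ac)
    finally have "ennreal x \<le> ennreal (e powr (- d) * (x powr (1 + d) * H powr (- d)))"
      by (rule ennreal_leI)
    then show ?thesis using real
      by (simp add: enn_powr_ennreal ennreal_mult add_increasing)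
  qed
qed (use e H in \<open>simp add: ennreal_mult_eq_top_iff\<close>)

text \<open>
  A form of Young's inequality without constants; the two cases \<open>S \<le> H\<^sup>e w\<close> and \<open>S > H\<^sup>e w\<close> give one summand each.
\<close>

lemma product_le_dual_powers:
  fixes H S w e :: real
  assumes H: "0 < H" and S: "0 < S" and w: "0 < w" and e: "0 < e"
  shows "H * S \<le> H powr (1 + e) * w + S powr (1 + 1 / e) * w powr (- 1 / e)"
proof (cases "S \<le> H powr e * w")
  case True
  then have "H * S \<le> H * (H powr e * w)" using mult_left_mono[OF True, of H] H by simp
  also have "\<dots> = H powr (1 + e) * w" using H by (simp add: powr_add)
  finally show ?thesis by (simp add: add_increasing2)
next
  case False
  then have "H powr e \<le> S / w" using w by (simp add: field_simps)
  then have "(H powr e) powr (1 / e) \<le> (S / w) powr (1 / e)" using e by (intro powr_mono2) auto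
  then have "H \<le> (S / w) powr (1 / e)" using H e by (simp add: powr_powr)
  then have "H * S \<le> (S / w) powr (1 / e) * S" using mult_right_mono[of H "(S / w) powr (1 / e)" S] S by simp
  also have "\<dots> = S powr (1 + 1 / e) * w powr (- 1 / e)"
    using S w by (simp add: powr_divide powr_add powr_minus_divide)
  finally show ?thesis using w by (simp add: add_increasing)
qed

text \<open>
  The heart of the extrapolation theorem, with \<open>r = 1 + d\<close> and \<open>q = 1 + e\<close>.  Let \<open>f\<close> be \<open>F\<close> normalized in
  \<open>L\<^sup>q(w)\<close>, let \<open>H\<close> be an \<open>A\<^sub>1\<close> majorant of both \<open>f\<close> and \<open>G\<close> obtained in \<open>L\<^sup>q(w)\<close>, and let \<open>S\<close> be an
  \<open>A\<^sub>1\<close> majorant of the dual function \<open>f\<^sup>e w\<close> obtained in the dual space.  Then \<open>W = H\<^sup>-\<^sup>d S\<close> is a weight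
  for the exponent \<open>r\<close>, and \<open>\<integral> H S\<close> is bounded.  From \<open>G \<le> H\<close> one gets \<open>\<integral> G\<^sup>r W \<le> \<integral> H S\<close>, so the
  hypothesis bounds \<open>\<integral> F\<^sup>r W\<close>.  On the other hand \<open>1 = \<integral> f\<^sup>q w \<le> \<integral> f S\<close>, and \<open>f\<close> is at most
  \<open>\<epsilon> H\<close> plus a multiple of \<open>f\<^sup>r H\<^sup>-\<^sup>d\<close>; the first part is absorbed and the second one is a multiple of
  \<open>\<integral> F\<^sup>r W\<close>.  Solving for the norm of \<open>F\<close> gives the bound.
\<close>

lemma extrapolation_normalized:
  assumes d: "0 < d" and e: "0 < e" and c: "0 < c"
  shows "\<exists>B>0. \<forall>F G a b. weighted_bound (1 + d) N F G \<longrightarrow> A1 c a \<longrightarrow> A1 c b \<longrightarrow>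
     (\<integral>\<^sup>+x. G x powr\<^sub>e (1 + e) * ennreal (factored_weight e a b x) \<partial>lborel) \<le> 1 \<longrightarrow>
     (\<integral>\<^sup>+x. F x powr\<^sub>e (1 + e) * ennreal (factored_weight e a b x) \<partial>lborel) < top \<longrightarrow>
     (\<integral>\<^sup>+x. F x powr\<^sub>e (1 + e) * ennreal (factored_weight e a b x) \<partial>lborel) \<le> ennreal B"
proof -
  obtain D1 E1 where D1: "0 < D1" "0 < E1" and maj1: "\<And>a b h. A1 c a \<Longrightarrow> A1 c b \<Longrightarrow> h \<in> borel_measurable borel \<Longrightarrow>
     (\<integral>\<^sup>+x. h x powr\<^sub>e (1 + e) * ennreal (factored_weight e a b x) \<partial>lborel) < top \<Longrightarrow>
     \<not> (AE x in lborel. h x = 0) \<Longrightarrow>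
     (\<exists>H. A1 D1 H \<and> (AE x in lborel. h x \<le> ennreal (H x)) \<and>
        (\<integral>\<^sup>+x. ennreal (H x) powr\<^sub>e (1 + e) * ennreal (factored_weight e a b x) \<partial>lborel)
          \<le> ennreal E1 * (\<integral>\<^sup>+x. h x powr\<^sub>e (1 + e) * ennreal (factored_weight e a b x) \<partial>lborel))"
    using A1_majorant[OF e c] by blast
  have "0 < 1 / e" using e by simp
  then obtain D2 E2 where D2: "0 < D2" "0 < E2" and maj2: "\<And>a b h. A1 c a \<Longrightarrow> A1 c b \<Longrightarrow> h \<in> borel_measurable borel \<Longrightarrow>
     (\<integral>\<^sup>+x. h x powr\<^sub>e (1 + 1 / e) * ennreal (factored_weight (1 / e) a b x) \<partial>lborel) < top \<Longrightarrow>
     \<not> (AE x in lborel. h x = 0) \<Longrightarrow>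
     (\<exists>H. A1 D2 H \<and> (AE x in lborel. h x \<le> ennreal (H x)) \<and>
        (\<integral>\<^sup>+x. ennreal (H x) powr\<^sub>e (1 + 1 / e) * ennreal (factored_weight (1 / e) a b x) \<partial>lborel)
          \<le> ennreal E2 * (\<integral>\<^sup>+x. h x powr\<^sub>e (1 + 1 / e) * ennreal (factored_weight (1 / e) a b x) \<partial>lborel))"
    using A1_majorant[OF _ c, of "1 / e"] by blast
  define D where "D = max D1 D2"
  have D: "0 < D" using D1 by (simp add: D_def)
  define T where "T = 2 * E1 + E2"
  have T: "0 < T" using D1 D2 by (simp add: T_def)
  \<comment> \<open>\<open>T\<close> will bound \<open>\<integral> H S\<close>, and \<open>\<epsilon>\<close> makes the absorbed part equal to \<open>1/2\<close>.\<close>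
  define \<epsilon> where "\<epsilon> = 1 / (2 * T)"
  have \<epsilon>: "0 < \<epsilon>" "\<epsilon> * T = 1 / 2" using T by (auto simp: \<epsilon>_def)
  define C where "C = \<epsilon> powr (- d) * (max 0 (N D) * T)"
  have C: "0 \<le> C" using T by (simp add: C_def)
  define B where "B = (2 * C) powr ((1 + e) / (1 + d)) + 1"
  have "(\<integral>\<^sup>+x. F x powr\<^sub>e (1 + e) * ennreal (factored_weight e a b x) \<partial>lborel) \<le> ennreal B"
    if W: "weighted_bound (1 + d) N F G" and a: "A1 c a" and b: "A1 c b"
      and G1: "(\<integral>\<^sup>+x. G x powr\<^sub>e (1 + e) * ennreal (factored_weight e a b x) \<partial>lborel) \<le> 1"
      and Ffin: "(\<integral>\<^sup>+x. F x powr\<^sub>e (1 + e) * ennreal (factored_weight e a b x) \<partial>lborel) < top"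
    for F G a b
  proof (cases "(\<integral>\<^sup>+x. F x powr\<^sub>e (1 + e) * ennreal (factored_weight e a b x) \<partial>lborel) = 0")
    case False
    note [measurable] = A1_measurable[OF a] A1_measurable[OF b]
    have [measurable]: "F \<in> borel_measurable borel" "G \<in> borel_measurable borel"
      using W by (auto simp: weighted_bound_def)
    let ?w = "factored_weight e a b" and ?v = "factored_weight (1 / e) b a"
    have wp: "0 < ?w x" for x by (rule factored_weight_pos[OF a b])
    have wv: "?v x = ?w x powr (- 1 / e)" for x by (rule factored_weight_dual[OF a b e])
    obtain A where A: "0 < A" "(\<integral>\<^sup>+x. F x powr\<^sub>e (1 + e) * ennreal (?w x) \<partial>lborel) = ennreal A"
      using Ffin False
      by (cases "(\<integral>\<^sup>+x. F x powr\<^sub>e (1 + e) * ennreal (?w x) \<partial>lborel)") (auto simp: less_le)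
    define \<rho> where "\<rho> = A powr (1 / (1 + e))"
    have \<rho>: "0 < \<rho>" "\<rho> powr (1 + e) = A" using A e by (auto simp: \<rho>_def powr_powr)
    define f where "f x = ennreal (1 / \<rho>) * F x" for x
    have [measurable]: "f \<in> borel_measurable borel" unfolding f_def by measurable
    have f1: "(\<integral>\<^sup>+x. f x powr\<^sub>e (1 + e) * ennreal (?w x) \<partial>lborel) = 1"
    proof -
      have "(\<integral>\<^sup>+x. f x powr\<^sub>e (1 + e) * ennreal (?w x) \<partial>lborel)
        = (\<integral>\<^sup>+x. ennreal (1 / A) * (F x powr\<^sub>e (1 + e) * ennreal (?w x)) \<partial>lborel)"
        unfolding f_def using e \<rho>
        by (intro nn_integral_cong) (simp add: enn_powr_mult enn_powr_ennreal powr_divide mult.assoc)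
      also have "\<dots> = ennreal (1 / A) * ennreal A"
        unfolding A(2)[symmetric] by (rule nn_integral_cmult) measurable
      finally show ?thesis using A(1) by (simp add: ennreal_mult[symmetric])
    qed
    have fnz: "\<not> (AE x in lborel. f x = 0)"
    proof
      assume "AE x in lborel. f x = 0"
      then have "AE x in lborel. f x powr\<^sub>e (1 + e) * ennreal (?w x) = 0"
        by eventually_elim simp
      then have "(\<integral>\<^sup>+x. f x powr\<^sub>e (1 + e) * ennreal (?w x) \<partial>lborel) = 0"
        by (subst nn_integral_0_iff_AE) auto
      with f1 show False by simp
    qed
    define h where "h x = max (f x) (G x)" for x
    have [measurable]: "h \<in> borel_measurable borel" unfolding h_def by measurable
    have h2: "(\<integral>\<^sup>+x. h x powr\<^sub>e (1 + e) * ennreal (?w x) \<partial>lborel) \<le> 2"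
    proof -
      have "(\<integral>\<^sup>+x. h x powr\<^sub>e (1 + e) * ennreal (?w x) \<partial>lborel)
        \<le> (\<integral>\<^sup>+x. f x powr\<^sub>e (1 + e) * ennreal (?w x) + G x powr\<^sub>e (1 + e) * ennreal (?w x) \<partial>lborel)"
        by (intro nn_integral_mono) (auto simp: h_def max_def add_increasing add_increasing2)
      also have "\<dots> = (\<integral>\<^sup>+x. f x powr\<^sub>e (1 + e) * ennreal (?w x) \<partial>lborel)
          + (\<integral>\<^sup>+x. G x powr\<^sub>e (1 + e) * ennreal (?w x) \<partial>lborel)"
        by (rule nn_integral_add) measurable
      also have "\<dots> \<le> 1 + 1" unfolding f1 by (intro add_mono G1 order_refl)
      finally show ?thesis by simp
    qed
    have "\<not> (AE x in lborel. h x = 0)"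
    proof
      assume "AE x in lborel. h x = 0"
      then have "AE x in lborel. f x = 0"
        by eventually_elim (auto simp: h_def max_def split: if_splits)
      with fnz show False ..
    qed
    with maj1[OF a b, of h] h2 obtain H where H: "A1 D1 H" "AE x in lborel. h x \<le> ennreal (H x)"
        "(\<integral>\<^sup>+x. ennreal (H x) powr\<^sub>e (1 + e) * ennreal (?w x) \<partial>lborel)
          \<le> ennreal E1 * (\<integral>\<^sup>+x. h x powr\<^sub>e (1 + e) * ennreal (?w x) \<partial>lborel)"
      by (auto simp: le_less_trans[OF h2])
    define k where "k x = f x powr\<^sub>e e * ennreal (?w x)" for x
    have [measurable]: "k \<in> borel_measurable borel" unfolding k_def by measurable
    have k1: "(\<integral>\<^sup>+x. k x powr\<^sub>e (1 + 1 / e) * ennreal (?v x) \<partial>lborel) = 1"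
      unfolding f1[symmetric]
    proof (rule nn_integral_cong)
      fix x
      have ee: "e * (1 + 1 / e) = 1 + e" using e by (simp add: distrib_left)
      have "k x powr\<^sub>e (1 + 1 / e) * ennreal (?v x)
        = (f x powr\<^sub>e e) powr\<^sub>e (1 + 1 / e) * (ennreal (?w x powr (1 + 1 / e)) * ennreal (?v x))"
        unfolding k_def using e wp[of x]
        by (simp add: enn_powr_mult add_pos_pos enn_powr_ennreal mult.assoc)
      also have "ennreal (?w x powr (1 + 1 / e)) * ennreal (?v x) = ennreal (?w x)"
        unfolding wv using wp[of x] by (simp add: ennreal_mult[symmetric] powr_add[symmetric])
      finally show "k x powr\<^sub>e (1 + 1 / e) * ennreal (?v x) = f x powr\<^sub>e (1 + e) * ennreal (?w x)"
        by (simp add: enn_powr_powr ee)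
    qed
    have "\<not> (AE x in lborel. k x = 0)"
    proof
      assume "AE x in lborel. k x = 0"
      then have "AE x in lborel. f x = 0"
      proof eventually_elim
        case (elim x)
        then show ?case using wp[of x] by (simp add: k_def ennreal_eq_0_iff not_le)
      qed
      with fnz show False ..
    qed
    with maj2[OF b a, of k] k1 obtain S where S: "A1 D2 S" "AE x in lborel. k x \<le> ennreal (S x)"
        "(\<integral>\<^sup>+x. ennreal (S x) powr\<^sub>e (1 + 1 / e) * ennreal (?v x) \<partial>lborel) \<le> ennreal E2"
      by auto
    note [measurable] = A1_measurable[OF H(1)] A1_measurable[OF S(1)]
    note Hp = A1_pos[OF H(1)] and Sp = A1_pos[OF S(1)]
    have HS: "(\<integral>\<^sup>+x. ennreal (H x * S x) \<partial>lborel) \<le> ennreal T"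
    proof -
      have "(\<integral>\<^sup>+x. ennreal (H x * S x) \<partial>lborel)
        \<le> (\<integral>\<^sup>+x. ennreal (H x) powr\<^sub>e (1 + e) * ennreal (?w x)
             + ennreal (S x) powr\<^sub>e (1 + 1 / e) * ennreal (?v x) \<partial>lborel)"
      proof (rule nn_integral_mono)
        fix x
        have "ennreal (H x * S x) \<le> ennreal (H x powr (1 + e) * ?w x + S x powr (1 + 1 / e) * ?v x)"
          unfolding wv by (intro ennreal_leI product_le_dual_powers Hp Sp wp e)
        also have "\<dots> = ennreal (H x) powr\<^sub>e (1 + e) * ennreal (?w x)
             + ennreal (S x) powr\<^sub>e (1 + 1 / e) * ennreal (?v x)"
          using Hp[of x] Sp[of x] wp[of x]
          by (simp add: enn_powr_ennreal ennreal_mult[symmetric] wv)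
        finally show "ennreal (H x * S x) \<le> ennreal (H x) powr\<^sub>e (1 + e) * ennreal (?w x)
             + ennreal (S x) powr\<^sub>e (1 + 1 / e) * ennreal (?v x)" .
      qed
      also have "\<dots> = (\<integral>\<^sup>+x. ennreal (H x) powr\<^sub>e (1 + e) * ennreal (?w x) \<partial>lborel)
          + (\<integral>\<^sup>+x. ennreal (S x) powr\<^sub>e (1 + 1 / e) * ennreal (?v x) \<partial>lborel)"
        by (rule nn_integral_add) measurable
      also have "\<dots> \<le> ennreal E1 * 2 + ennreal E2"
        by (intro add_mono S(3) order_trans[OF H(3)] mult_left_mono h2) auto
      also have "\<dots> = ennreal T"
        using D1 D2 by (simp add: T_def mult.commute ennreal_mult)
      finally show ?thesis .
    qed
    have HD: "A1 D H" "A1 D S" using H(1) S(1) by (auto simp: D_def intro: A1_mono)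
    let ?W = "factored_weight d H S"
    have "(\<integral>\<^sup>+x. F x powr\<^sub>e (1 + d) * ennreal (?W x) \<partial>lborel)
      \<le> ennreal (N D) * (\<integral>\<^sup>+x. G x powr\<^sub>e (1 + d) * ennreal (?W x) \<partial>lborel)"
      using W HD D by (auto simp: weighted_bound_def)
    also have "\<dots> \<le> ennreal (max 0 (N D)) * (\<integral>\<^sup>+x. ennreal (H x * S x) \<partial>lborel)"
    proof (intro mult_mono)
      have "AE x in lborel. G x powr\<^sub>e (1 + d) * ennreal (?W x) \<le> ennreal (H x * S x)"
        using H(2)
      proof eventually_elim
        case (elim x)
        then have "G x \<le> ennreal (H x)" by (simp add: h_def)
        then have "G x powr\<^sub>e (1 + d) * ennreal (?W x) \<le> ennreal (H x) powr\<^sub>e (1 + d) * ennreal (?W x)"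
          using d by (intro mult_right_mono enn_powr_mono) auto
        also have "\<dots> = ennreal (H x * S x)"
          using Hp[of x] Sp[of x]
          by (simp add: enn_powr_ennreal ennreal_mult[symmetric] factored_weight_def mult.assoc[symmetric]
              powr_add[symmetric])
        finally show ?case .
      qed
      then show "(\<integral>\<^sup>+x. G x powr\<^sub>e (1 + d) * ennreal (?W x) \<partial>lborel) \<le> (\<integral>\<^sup>+x. ennreal (H x * S x) \<partial>lborel)"
        by (rule nn_integral_mono_AE)
    qed (auto intro: ennreal_leI)
    also have "\<dots> \<le> ennreal (max 0 (N D)) * ennreal T"
      by (intro mult_left_mono HS) auto
    finally have FW: "(\<integral>\<^sup>+x. F x powr\<^sub>e (1 + d) * ennreal (?W x) \<partial>lborel) \<le> ennreal (max 0 (N D) * T)"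
      using T by (simp add: ennreal_mult)
    have "1 = (\<integral>\<^sup>+x. f x * k x \<partial>lborel)"
      unfolding f1[symmetric] k_def
    proof (rule nn_integral_cong)
      fix x
      show "f x powr\<^sub>e (1 + e) * ennreal (?w x) = f x * (f x powr\<^sub>e e * ennreal (?w x))"
        by (simp add: enn_powr_add mult.assoc)
    qed
    also have "\<dots> \<le> (\<integral>\<^sup>+x. ennreal \<epsilon> * ennreal (H x * S x)
        + ennreal (\<epsilon> powr (- d) * (1 / \<rho>) powr (1 + d)) * (F x powr\<^sub>e (1 + d) * ennreal (?W x)) \<partial>lborel)"
    proof (rule nn_integral_mono_AE, rule eventually_mono[OF S(2)])
      fix x assume "k x \<le> ennreal (S x)"
      then have "f x * k x \<le> f x * ennreal (S x)" by (intro mult_left_mono) auto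
      also have "\<dots> \<le> (ennreal (\<epsilon> * H x) + ennreal (\<epsilon> powr (- d)) *
          (f x powr\<^sub>e (1 + d) * ennreal (H x powr (- d)))) * ennreal (S x)"
        by (intro mult_right_mono split_le_weighted_power \<epsilon>(1) d Hp) auto
      also have "\<dots> = ennreal (\<epsilon> * H x) * ennreal (S x) + ennreal (\<epsilon> powr (- d)) *
          (f x powr\<^sub>e (1 + d) * (ennreal (H x powr (- d)) * ennreal (S x)))"
        by (simp only: distrib_right mult.assoc)
      also have "ennreal (H x powr (- d)) * ennreal (S x) = ennreal (?W x)"
        using Sp[of x] by (simp add: factored_weight_def ennreal_mult)
      also have "ennreal (\<epsilon> * H x) * ennreal (S x) = ennreal \<epsilon> * ennreal (H x * S x)"
        using \<epsilon>(1) Hp[of x] Sp[of x] by (simp add: ennreal_mult mult.assoc)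
      also have "f x powr\<^sub>e (1 + d) = ennreal ((1 / \<rho>) powr (1 + d)) * F x powr\<^sub>e (1 + d)"
        unfolding f_def using d \<rho>(1) by (simp add: enn_powr_mult enn_powr_ennreal)
      also have "ennreal (\<epsilon> powr (- d)) * (ennreal ((1 / \<rho>) powr (1 + d)) * F x powr\<^sub>e (1 + d) * ennreal (?W x))
        = ennreal (\<epsilon> powr (- d) * (1 / \<rho>) powr (1 + d)) * (F x powr\<^sub>e (1 + d) * ennreal (?W x))"
        by (simp add: ennreal_mult mult.assoc)
      finally show "f x * k x \<le> ennreal \<epsilon> * ennreal (H x * S x)
        + ennreal (\<epsilon> powr (- d) * (1 / \<rho>) powr (1 + d)) * (F x powr\<^sub>e (1 + d) * ennreal (?W x))" .
    qed
    also have "\<dots> = ennreal \<epsilon> * (\<integral>\<^sup>+x. ennreal (H x * S x) \<partial>lborel)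
        + ennreal (\<epsilon> powr (- d) * (1 / \<rho>) powr (1 + d)) *
          (\<integral>\<^sup>+x. F x powr\<^sub>e (1 + d) * ennreal (?W x) \<partial>lborel)"
      by (subst nn_integral_add) (auto simp: nn_integral_cmult)
    also have "\<dots> \<le> ennreal \<epsilon> * ennreal T
        + ennreal (\<epsilon> powr (- d) * (1 / \<rho>) powr (1 + d)) * ennreal (max 0 (N D) * T)"
      by (intro add_mono mult_left_mono HS FW) auto
    also have "\<dots> = ennreal (1 / 2 + (1 / \<rho>) powr (1 + d) * C)"
      using \<epsilon> T
      by (simp add: ennreal_mult[symmetric] C_def mult_ac ennreal_plus[symmetric] del: ennreal_plus)
    finally have "1 \<le> 1 / 2 + (1 / \<rho>) powr (1 + d) * C"
      using C by (subst (asm) ennreal_1[symmetric], subst (asm) ennreal_le_iff) (auto intro!: add_nonneg_nonneg)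
    then have "\<rho> powr (1 + d) \<le> 2 * C"
      using \<rho>(1) by (simp add: powr_divide field_simps)
    then have "(\<rho> powr (1 + d)) powr ((1 + e) / (1 + d)) \<le> (2 * C) powr ((1 + e) / (1 + d))"
      using d e by (intro powr_mono2) auto
    then have "A \<le> B" using d \<rho> by (simp add: powr_powr B_def)
    then show ?thesis unfolding A(2) by (rule ennreal_leI)
  qed simp
  moreover have "0 < B" by (simp add: B_def add_nonneg_pos)
  ultimately show ?thesis by blast
qed

text \<open>
  Removal of the normalizations.  That \<open>F\<close> has finite norm is achieved by truncating \<open>F\<close> in height, to a
  bounded interval and to a sublevel set of the weight, which only makes \<open>F\<close> smaller; that \<open>G\<close> has norm at most
  \<open>1\<close>, by multiplying both functions by a constant.
\<close>

lemma extrapolation: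
  assumes r: "1 < r" and q: "1 < q"
  shows "\<exists>K. \<forall>F G. weighted_bound r N F G \<longrightarrow> weighted_bound q K F G"
proof -
  define d where "d = r - 1"
  define e where "e = q - 1"
  have de: "0 < d" "0 < e" "r = 1 + d" "q = 1 + e" using r q by (auto simp: d_def e_def)
  let ?P = "\<lambda>c B. 0 < B \<and> (\<forall>F G a b. weighted_bound (1 + d) N F G \<longrightarrow> A1 c a \<longrightarrow> A1 c b \<longrightarrow>
     (\<integral>\<^sup>+x. G x powr\<^sub>e (1 + e) * ennreal (factored_weight e a b x) \<partial>lborel) \<le> 1 \<longrightarrow>
     (\<integral>\<^sup>+x. F x powr\<^sub>e (1 + e) * ennreal (factored_weight e a b x) \<partial>lborel) < top \<longrightarrow>
     (\<integral>\<^sup>+x. F x powr\<^sub>e (1 + e) * ennreal (factored_weight e a b x) \<partial>lborel) \<le> ennreal B)"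
  have "\<forall>c. \<exists>B. 0 < c \<longrightarrow> ?P c B"
    using extrapolation_normalized[OF de(1,2), of _ N] by blast
  from choice[OF this] obtain B where PB: "\<And>c. 0 < c \<Longrightarrow> ?P c (B c)" by blast
  have B: "\<And>c. 0 < c \<Longrightarrow> 0 < B c" and
    core: "\<And>c F G a b. 0 < c \<Longrightarrow> weighted_bound (1 + d) N F G \<Longrightarrow> A1 c a \<Longrightarrow> A1 c b \<Longrightarrow>
     (\<integral>\<^sup>+x. G x powr\<^sub>e (1 + e) * ennreal (factored_weight e a b x) \<partial>lborel) \<le> 1 \<Longrightarrow>
     (\<integral>\<^sup>+x. F x powr\<^sub>e (1 + e) * ennreal (factored_weight e a b x) \<partial>lborel) < top \<Longrightarrow>
     (\<integral>\<^sup>+x. F x powr\<^sub>e (1 + e) * ennreal (factored_weight e a b x) \<partial>lborel) \<le> ennreal (B c)"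
    using PB by blast+
  have "weighted_bound (1 + e) B F G" if W: "weighted_bound (1 + d) N F G" for F G
    unfolding weighted_bound_def
  proof (intro conjI allI impI)
    show Fm [measurable]: "F \<in> borel_measurable borel" and Gm [measurable]: "G \<in> borel_measurable borel"
      using W by (auto simp: weighted_bound_def)
    fix c :: real and a b assume c: "0 < c" and a: "A1 c a" and b: "A1 c b"
    note [measurable] = A1_measurable[OF a] A1_measurable[OF b]
    let ?w = "factored_weight e a b"
    have wp: "0 < ?w x" for x by (rule factored_weight_pos[OF a b])
    let ?N = "\<lambda>g. (\<integral>\<^sup>+x. g x powr\<^sub>e (1 + e) * ennreal (?w x) \<partial>lborel)"
    have sc: "?N (\<lambda>x. ennreal k * g x) = ennreal (k powr (1 + e)) * ?N g"
      if [measurable]: "g \<in> borel_measurable borel" and "0 \<le> k" for g k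
      using de(2) that(2)
      by (subst nn_integral_cmult[symmetric]) (auto simp: enn_powr_mult enn_powr_ennreal mult.assoc)
    have trunc: "?N F' \<le> ennreal (B c)"
      if W: "weighted_bound (1 + d) N F G" and G1: "?N G \<le> 1"
        and F'_def: "F' = (\<lambda>x. min (F x) (of_nat n) * indicator {x. \<bar>x\<bar> \<le> real n \<and> ?w x \<le> real n} x)"
      for F G F' and n :: nat
    proof -
      have [measurable]: "F \<in> borel_measurable borel" using W by (auto simp: weighted_bound_def)
      have [measurable]: "F' \<in> borel_measurable borel" unfolding F'_def by measurable
      have "weighted_bound (1 + d) N F' G"
        by (rule weighted_bound_mono[OF W]) (use de in \<open>auto simp: F'_def indicator_def\<close>)
      moreover have "?N F' < top"
      proof -
        have "?N F' \<le> (\<integral>\<^sup>+x. ennreal (real n powr (1 + e) * real n) * indicator {- real n..real n} x \<partial>lborel)"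
        proof (rule nn_integral_mono)
          fix x
          show "F' x powr\<^sub>e (1 + e) * ennreal (?w x) \<le> ennreal (real n powr (1 + e) * real n) * indicator {- real n..real n} x"
          proof (cases "\<bar>x\<bar> \<le> real n \<and> ?w x \<le> real n")
            case True
            have "F' x \<le> ennreal (real n)" using True by (simp add: F'_def ennreal_of_nat_eq_real_of_nat)
            then have "F' x powr\<^sub>e (1 + e) \<le> ennreal (real n powr (1 + e))"
              using enn_powr_mono[of "1 + e" "F' x" "ennreal (real n)"] de(2) by (simp add: enn_powr_ennreal)
            then have "F' x powr\<^sub>e (1 + e) * ennreal (?w x) \<le> ennreal (real n powr (1 + e)) * ennreal (real n)"
              using True by (intro mult_mono) (auto intro: ennreal_leI)
            then show ?thesis using True by (simp add: ennreal_mult indicator_def abs_le_iff)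
          qed (simp add: F'_def)
        qed
        also have "\<dots> < top"
          by (subst nn_integral_cmult_indicator) (auto simp: ennreal_mult_less_top)
        finally show ?thesis .
      qed
      ultimately show ?thesis using core[OF c _ a b G1] by blast
    qed
    have norm1: "?N F \<le> ennreal (B c)" if W: "weighted_bound (1 + d) N F G" and G1: "?N G \<le> 1" for F G
    proof -
      have [measurable]: "F \<in> borel_measurable borel" using W by (auto simp: weighted_bound_def)
      define F' where "F' n = (\<lambda>x. min (F x) (of_nat n) * indicator {x. \<bar>x\<bar> \<le> real n \<and> ?w x \<le> real n} x)" for n :: nat
      have [measurable]: "F' n \<in> borel_measurable borel" for n unfolding F'_def by measurable
      have inc: "F' m x \<le> F' n x" if "m \<le> n" for m n x
      proof (cases "\<bar>x\<bar> \<le> real m \<and> ?w x \<le> real m")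
        case True
        moreover have "real m \<le> real n" using that by simp
        ultimately have "\<bar>x\<bar> \<le> real n \<and> ?w x \<le> real n" by linarith
        with True show ?thesis
          using min.mono[OF order_refl[of "F x"] of_nat_mono[OF that, where 'a = ennreal]]
          by (simp add: F'_def)
      qed (simp add: F'_def)
      have SUPF: "(SUP n. F' n x) = F x" for x
      proof (rule antisym)
        show "(SUP n. F' n x) \<le> F x" by (intro SUP_least) (auto simp: F'_def indicator_def)
        obtain n0 :: nat where n0: "\<bar>x\<bar> \<le> real n0" "?w x \<le> real n0"
          using real_arch_simple[of "max \<bar>x\<bar> (?w x)"] by auto
        show "F x \<le> (SUP n. F' n x)"
        proof (rule dense_le)
          fix y assume y: "y < F x"
          then have "y < top" by (rule less_le_trans) simp
          then obtain n1 :: nat where n1: "y < of_nat n1"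
            using ennreal_Ex_less_of_nat by blast
          let ?n = "max n0 n1"
          have "y \<le> min (F x) (of_nat ?n)"
          proof (rule min.boundedI)
            have "y \<le> of_nat n1" using n1 by simp
            also have "\<dots> \<le> of_nat ?n" by (rule of_nat_mono) simp
            finally show "y \<le> of_nat ?n" .
          qed (use y in simp)
          moreover have "\<bar>x\<bar> \<le> real ?n \<and> ?w x \<le> real ?n" using n0 by linarith
          ultimately have "y \<le> F' ?n x" by (simp add: F'_def)
          also have "\<dots> \<le> (SUP n. F' n x)" by (rule SUP_upper) simp
          finally show "y \<le> (SUP n. F' n x)" .
        qed
      qed
      have "?N F = (\<integral>\<^sup>+x. (SUP n. F' n x powr\<^sub>e (1 + e) * ennreal (?w x)) \<partial>lborel)"
        using de(2) by (simp add: SUPF[symmetric] SUP_enn_powr SUP_mult_right_ennreal)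
      also have "\<dots> = (SUP n. ?N (F' n))"
        using de(2) by (intro nn_integral_monotone_convergence_SUP)
          (auto simp: incseq_def le_fun_def intro!: mult_right_mono enn_powr_mono inc)
      also have "\<dots> \<le> ennreal (B c)"
        by (intro SUP_least trunc[OF W G1]) (simp add: F'_def)
      finally show ?thesis .
    qed
    show "(\<integral>\<^sup>+x. F x powr\<^sub>e (1 + e) * ennreal (factored_weight (1 + e - 1) a b x) \<partial>lborel)
         \<le> ennreal (B c) * (\<integral>\<^sup>+x. G x powr\<^sub>e (1 + e) * ennreal (factored_weight (1 + e - 1) a b x) \<partial>lborel)"
    proof (cases "?N G")
      case (real A)
      have "?N F \<le> ennreal (A * B c)"
      proof (rule ennreal_le_epsilon)
        fix t :: real assume t: "0 < t"
        \<comment> \<open>Adding \<open>t / B c\<close> covers the case \<open>A = 0\<close>, in which \<open>G\<close> has no multiple of norm one.\<close>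
        define x where "x = A + t / B c"
        have x: "0 < x" "A \<le> x" "x * B c = A * B c + t"
          using t real(1) B[OF c] by (simp_all add: x_def add_nonneg_pos distrib_right)
        define k where "k = (1 / x) powr (1 / (1 + e))"
        have k: "0 < k" "k powr (1 + e) = 1 / x" using x de(2) by (auto simp: k_def powr_powr)
        have "?N (\<lambda>y. ennreal k * G y) \<le> 1"
          unfolding sc[OF Gm less_imp_le[OF k(1)]] k(2) real(2)
          using x real(1) by (simp add: ennreal_mult[symmetric])
        then have "?N (\<lambda>y. ennreal k * F y) \<le> ennreal (B c)"
          using de(1) by (intro norm1[OF weighted_bound_scale[OF W, of "ennreal k"]]) auto
        then have "ennreal x * (ennreal (1 / x) * ?N F) \<le> ennreal x * ennreal (B c)"
          unfolding sc[OF Fm less_imp_le[OF k(1)]] k(2) by (intro mult_left_mono) auto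
        also have "ennreal x * (ennreal (1 / x) * ?N F) = ?N F"
          using x by (simp add: mult.assoc[symmetric] ennreal_mult[symmetric])
        also have "ennreal x * ennreal (B c) = ennreal (A * B c) + ennreal t"
          using x(1) x(3) real(1) t B[OF c] by (simp add: ennreal_mult[symmetric])
        finally show "?N F \<le> ennreal (A * B c) + ennreal t" .
      qed
      then show ?thesis using real B[OF c] by (simp add: ennreal_mult mult.commute)
    qed (use B[OF c] in \<open>simp add: ennreal_mult_top\<close>)
  qed
  then show ?thesis using de by blast
qed

section \<open>Maximal operators and mixed norms\<close>

lemma interval_bounds:
  assumes I: "is_interval (I :: real set)" and x: "x \<in> I" and m: "emeasure lborel I = ennreal m" "0 \<le> m"
  obtains s S where "s \<le> S" "I \<subseteq> {s..S}" "S - s \<le> m"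
proof
  have diam: "z - y \<le> m" if "y \<in> I" "z \<in> I" for y z
  proof (cases "y \<le> z")
    case True
    have "{y..z} \<subseteq> I" using mem_is_interval_1_I[OF I that] by auto
    then have "emeasure lborel {y..z} \<le> emeasure lborel I"
      using I by (intro emeasure_mono) (auto simp: real_interval_borel_measurable)
    then show ?thesis using True m by simp
  qed (use m(2) in linarith)
  have bd: "bdd_below I" "bdd_above I"
  proof -
    have *: "x - m \<le> z" "z \<le> x + m" if "z \<in> I" for z
      using diam[OF that x] diam[OF x that] by simp_all
    show "bdd_below I" by (rule bdd_belowI[OF *(1)])
    show "bdd_above I" by (rule bdd_aboveI[OF *(2)])
  qed
  show "I \<subseteq> {Inf I..Sup I}" using bd by (auto intro: cInf_lower cSup_upper)
  then show "Inf I \<le> Sup I" using x by auto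
  have "Sup I \<le> m + Inf I"
  proof (rule cSup_least)
    fix z assume z: "z \<in> I"
    have "z - m \<le> Inf I"
    proof (rule cInf_greatest)
      fix y assume "y \<in> I"
      then show "z - m \<le> y" using diam[OF _ z, of y] by simp
    qed (use x in auto)
    then show "z \<le> m + Inf I" by simp
  qed (use x in auto)
  then show "Sup I - Inf I \<le> m" by simp
qed

text \<open>
  Averages over arbitrary intervals are controlled by those over rational open ones: an interval of length
  \<open>m\<close> lies in a rational one of length at most \<open>m + e\<close>, for every \<open>e > 0\<close>.
\<close>

lemma maximal_op_eq_wmax: "maximal_op k F x = wmax lborel (\<lambda>y. F (x(k := y))) (x k)"
proof (rule antisym)
  let ?A = "\<lambda>I. \<integral>\<^sup>+y\<in>I. F (x(k := y)) \<partial>lborel"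
  show "wmax lborel (\<lambda>y. F (x(k := y))) (x k) \<le> maximal_op k F x"
    unfolding wmax_def maximal_op_def
  proof (rule SUP_subset_mono)
    show "{I \<in> rat_ivls. x k \<in> I} \<subseteq> {I. is_interval I \<and> x k \<in> I \<and> 0 < emeasure lborel I \<and> emeasure lborel I < \<infinity>}"
      using lborel_ivl.fin_ivl lborel_ivl.pos_ivl by (auto simp: rat_ivls_def is_interval_oo)
  qed simp
  show "maximal_op k F x \<le> wmax lborel (\<lambda>y. F (x(k := y))) (x k)"
    unfolding maximal_op_def
  proof (rule SUP_least)
    fix I assume "I \<in> {I. is_interval I \<and> x k \<in> I \<and> 0 < emeasure lborel I \<and> emeasure lborel I < \<infinity>}"
    then have I: "is_interval I" "x k \<in> I" "0 < emeasure lborel I" "emeasure lborel I < \<infinity>" by auto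
    then obtain m where m: "emeasure lborel I = ennreal m" "0 < m"
      by (cases "emeasure lborel I") auto
    obtain s S where sS: "s \<le> S" "I \<subseteq> {s..S}" "S - s \<le> m"
      using interval_bounds[OF I(1,2) m(1)] m(2) by auto
    let ?W = "wmax lborel (\<lambda>y. F (x(k := y))) (x k)"
    have step: "?A I \<le> ?W * (ennreal m + ennreal e)" if e: "0 < e" for e
    proof -
      obtain J where J: "J \<in> rat_ivls" "{s..S} \<subseteq> J" "emeasure lborel J \<le> ennreal (S - s + e)"
        using ex_rat_ivl[OF sS(1) e] by blast
      have "?A I \<le> ?A J"
        using J sS by (intro nn_integral_mono) (auto simp: indicator_def)
      also have "\<dots> \<le> ?W * emeasure lborel J"
        using J sS I by (intro lborel_ivl.wmax_upper') auto
      also have "\<dots> \<le> ?W * ennreal (m + e)"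
        using sS by (intro mult_left_mono order_trans[OF J(3)] ennreal_leI) auto
      also have "ennreal (m + e) = ennreal m + ennreal e" using m e by (intro ennreal_plus) auto
      finally show ?thesis .
    qed
    have "?A I \<le> ?W * ennreal m"
    proof (cases ?W)
      case (real w)
      show ?thesis
      proof (rule ennreal_le_epsilon)
        fix t :: real assume t: "0 < t"
        have "?A I \<le> ?W * (ennreal m + ennreal (t / (w + 1)))" using real t by (intro step) auto
        also have "\<dots> = ?W * ennreal m + ennreal (w * (t / (w + 1)))"
          using real t by (simp add: distrib_left ennreal_mult[symmetric])
        also have "\<dots> \<le> ?W * ennreal m + ennreal t"
          using real t by (intro add_left_mono ennreal_leI) (auto simp: field_simps)
        finally show "?A I \<le> ?W * ennreal m + ennreal t" .
      qed
    qed (use m in \<open>simp add: ennreal_top_mult\<close>)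
    then show "?A I / emeasure lborel I \<le> ?W"
      using m by (intro divide_le_posI_ennreal) (auto simp: mult.commute)
  qed
qed

text \<open>
  All functions on \<open>\<real>\<^sup>n\<close> are extended to functions of infinitely many variables, of which only the first \<open>n\<close>
  matter.  Then updating a coordinate stays within one measurable space, whatever the coordinate.
\<close>

abbreviation RN :: "(nat \<Rightarrow> real) measure" where
  "RN \<equiv> \<Pi>\<^sub>M i\<in>UNIV. (lborel :: real measure)"

lemma measurable_upd [measurable]:
  assumes f: "f \<in> M \<rightarrow>\<^sub>M RN" and g [measurable]: "g \<in> borel_measurable M"
  shows "(\<lambda>x. (f x)(k := g x)) \<in> M \<rightarrow>\<^sub>M RN"
proof (rule measurable_PiM_single')
  fix i :: nat
  have "(\<lambda>x. f x i) \<in> M \<rightarrow>\<^sub>M lborel"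
    using measurable_compose[OF f measurable_component_singleton[of i UNIV "\<lambda>_. lborel"]] by simp
  then show "(\<lambda>x. ((f x)(k := g x)) i) \<in> M \<rightarrow>\<^sub>M lborel"
    by (cases "i = k") auto
qed (auto simp: space_PiM)

lemma measurable_coord: "(\<lambda>x. x k) \<in> borel_measurable RN"
  using measurable_component_singleton[of k UNIV "\<lambda>_. lborel :: real measure"] by simp

lemma maximal_op_measurable [measurable]:
  assumes [measurable]: "F \<in> borel_measurable RN"
  shows "maximal_op k F \<in> borel_measurable RN"
proof -
  have "(\<lambda>x. (\<integral>\<^sup>+y\<in>I. F (x(k := y)) \<partial>lborel) / emeasure lborel I * indicator I (x k)) \<in> borel_measurable RN"
    if "I \<in> rat_ivls" for I
  proof -
    note [measurable] = rat_ivls_borel[OF that] measurable_coord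
    show ?thesis by measurable
  qed
  then have "(\<lambda>x. SUP I\<in>rat_ivls. (\<integral>\<^sup>+y\<in>I. F (x(k := y)) \<partial>lborel) / emeasure lborel I * indicator I (x k))
     \<in> borel_measurable RN"
    by (intro borel_measurable_SUP) auto
  then show ?thesis
    by (subst ext[OF maximal_op_eq_wmax, unfolded wmax_eq_SUP_indicator]) simp
qed

lemma iter_maximal_measurable [measurable]:
  "F \<in> borel_measurable RN \<Longrightarrow> iter_maximal k F \<in> borel_measurable RN"
  by (induction k) auto

lemma lu_norm_measurable [measurable]:
  assumes [measurable]: "\<And>j. g j \<in> borel_measurable M"
  shows "(\<lambda>x. lu_norm u (\<lambda>j. g j x)) \<in> borel_measurable M"
  unfolding lu_norm_def by (cases "u = \<infinity>") simp_all

text \<open>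
  The norm in the first \<open>k\<close> variables with the others frozen.  Unlike \<open>mixed_int\<close>, which postpones the outer
  root to the next integration, it is homogeneous of degree one at every stage, which suits induction.
\<close>

primrec mnorm :: "(nat \<Rightarrow> real) \<Rightarrow> nat \<Rightarrow> ((nat \<Rightarrow> real) \<Rightarrow> ennreal) \<Rightarrow> (nat \<Rightarrow> real) \<Rightarrow> ennreal" where
  "mnorm p 0 F = F"
| "mnorm p (Suc k) F =
     (\<lambda>x. (\<integral>\<^sup>+y. mnorm p k F (x(Suc k := y)) powr\<^sub>e p (Suc k) \<partial>lborel) powr\<^sub>e (1 / p (Suc k)))"

lemma mnorm_measurable [measurable]:
  "F \<in> borel_measurable RN \<Longrightarrow> mnorm p k F \<in> borel_measurable RN"
  by (induction k) auto

lemma mixed_int_eq_mnorm: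
  assumes "\<And>i. i \<in> {1..k} \<Longrightarrow> 0 < p i"
  shows "mixed_int p k F x = (if k = 0 then F x else mnorm p k F x powr\<^sub>e p k)"
  using assms
proof (induction k arbitrary: x)
  case (Suc k)
  have IH: "mixed_int p k F y powr\<^sub>e (if k = 0 then p 1 else p (Suc k) / p k) = mnorm p k F y powr\<^sub>e p (Suc k)" for y
  proof (cases "k = 0")
    case False
    then have "0 < p k" by (intro Suc.prems) auto
    moreover have "mixed_int p k F y = mnorm p k F y powr\<^sub>e p k"
      using False Suc.prems by (subst Suc.IH) auto
    ultimately show ?thesis using False by (simp add: enn_powr_powr)
  qed simp
  show ?case using Suc.prems[of "Suc k"] by (simp add: IH enn_powr_powr)
qed simp

lemma mixed_norm_eq_mnorm:
  assumes "1 \<le> n" "\<And>i. i \<in> {1..n} \<Longrightarrow> 0 < p i"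
  shows "mixed_norm n p F = mnorm p n F (\<lambda>_. undefined)"
proof -
  have "0 < p n" using assms by simp
  moreover have "mixed_int p n F x = mnorm p n F x powr\<^sub>e p n" for x
    using assms by (subst mixed_int_eq_mnorm) auto
  ultimately show ?thesis by (simp add: mixed_norm_def enn_powr_powr)
qed

text \<open>
  An inequality between the norms in the first \<open>k\<close> variables is inherited by the full norm.
\<close>

lemma mnorm_mono_cmult:
  assumes [measurable]: "G \<in> borel_measurable RN"
    and le: "\<And>x. mnorm p k F x \<le> c * mnorm p k G x" and "k \<le> n"
    and p: "\<And>i. i \<in> {1..n} \<Longrightarrow> 0 < p i"
  shows "mnorm p n F x \<le> c * mnorm p n G x"
  using \<open>k \<le> n\<close> p
proof (induction n arbitrary: x rule: dec_induct)
  case (step n)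
  have pos: "0 < p (Suc n)" using step.prems by simp
  have IH: "mnorm p n F x \<le> c * mnorm p n G x" for x
    using step.prems by (intro step.IH) auto
  have "mnorm p (Suc n) F x \<le> (\<integral>\<^sup>+y. (c * mnorm p n G (x(Suc n := y))) powr\<^sub>e p (Suc n) \<partial>lborel) powr\<^sub>e (1 / p (Suc n))"
    using pos IH by (auto intro!: enn_powr_mono nn_integral_mono)
  also have "(\<integral>\<^sup>+y. (c * mnorm p n G (x(Suc n := y))) powr\<^sub>e p (Suc n) \<partial>lborel)
    = c powr\<^sub>e p (Suc n) * (\<integral>\<^sup>+y. mnorm p n G (x(Suc n := y)) powr\<^sub>e p (Suc n) \<partial>lborel)"
    using pos by (simp add: enn_powr_mult nn_integral_cmult space_PiM)
  also have "\<dots> powr\<^sub>e (1 / p (Suc n)) = c * mnorm p (Suc n) G x"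
    using pos by (simp add: enn_powr_mult enn_powr_powr)
  finally show ?case .
qed (use le in simp)

lemma wmax_weighted_bound:
  assumes "1 < r"
  shows "\<exists>N. \<forall>g. g \<in> borel_measurable borel \<longrightarrow> weighted_bound r N (wmax lborel g) g"
proof -
  let ?P = "\<lambda>c K. \<forall>a b g. A1 c a \<longrightarrow> A1 c b \<longrightarrow> g \<in> borel_measurable borel \<longrightarrow>
    (\<integral>\<^sup>+x. wmax lborel g x powr\<^sub>e r * ennreal (factored_weight (r - 1) a b x) \<partial>lborel)
      \<le> ennreal K * (\<integral>\<^sup>+x. g x powr\<^sub>e r * ennreal (factored_weight (r - 1) a b x) \<partial>lborel)"
  have "\<forall>c. \<exists>K. 0 < c \<longrightarrow> ?P c K"
  proof (intro allI)
    fix c :: real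
    show "\<exists>K. 0 < c \<longrightarrow> ?P c K"
      using maximal_weighted[of "r - 1" c] assms by (cases "0 < c") auto
  qed
  from choice[OF this] obtain N where "\<And>c. 0 < c \<Longrightarrow> ?P c (N c)" by blast
  then have "weighted_bound r N (wmax lborel g) g" if "g \<in> borel_measurable borel" for g
    using that by (auto simp: weighted_bound_def)
  then show ?thesis by blast
qed

text \<open>
  The weighted Fefferman-Stein inequality.  For finite \<open>v\<close> the scalar estimate with exponent \<open>v\<close> is
  summed over \<open>j\<close>; for \<open>v = \<infinity>\<close> one has \<open>sup\<^sub>j M g\<^sub>j \<le> M (sup\<^sub>j g\<^sub>j)\<close> and any exponent will do.  Extrapolation
  yields all other exponents.
\<close>

lemma lu_norm_maximal_weighted_bound:
  assumes v: "1 < v" and q: "1 < q"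
  shows "\<exists>N. \<forall>g. (\<forall>j. g j \<in> borel_measurable borel) \<longrightarrow>
     weighted_bound q N (\<lambda>y. lu_norm v (\<lambda>j. wmax lborel (g j) y)) (\<lambda>y. lu_norm v (\<lambda>j. g j y))"
proof -
  have "\<exists>r>1. \<exists>N. \<forall>g. (\<forall>j. g j \<in> borel_measurable borel) \<longrightarrow>
     weighted_bound r N (\<lambda>y. lu_norm v (\<lambda>j. wmax lborel (g j) y)) (\<lambda>y. lu_norm v (\<lambda>j. g j y))"
  proof (cases "v = \<infinity>")
    case True
    obtain N where N: "\<And>g. g \<in> borel_measurable borel \<Longrightarrow> weighted_bound 2 N (wmax lborel g) g"
      using wmax_weighted_bound[of 2] by auto
    have "weighted_bound 2 N (\<lambda>y. lu_norm v (\<lambda>j. wmax lborel (g j) y)) (\<lambda>y. lu_norm v (\<lambda>j. g j y))"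
      if [measurable]: "\<And>j. g j \<in> borel_measurable borel" for g :: "nat \<Rightarrow> real \<Rightarrow> ennreal"
    proof (rule weighted_bound_mono)
      show "weighted_bound 2 N (wmax lborel (\<lambda>y. lu_norm v (\<lambda>j. g j y))) (\<lambda>y. lu_norm v (\<lambda>j. g j y))"
        by (intro N) measurable
      show "lu_norm v (\<lambda>j. wmax lborel (g j) x) \<le> wmax lborel (\<lambda>y. lu_norm v (\<lambda>j. g j y)) x" for x
        using True by (auto simp: lu_norm_def intro!: SUP_least wmax_mono SUP_upper)
    qed auto
    then show ?thesis by (intro exI[of _ 2]) auto
  next
    case False
    define r where "r = enn2real v"
    have r: "1 < r" using v False unfolding r_def
      by (cases v) (auto simp: ennreal_less_iff simp flip: ennreal_1)
    obtain N where N: "\<And>g. g \<in> borel_measurable borel \<Longrightarrow> weighted_bound r N (wmax lborel g) g"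
      using wmax_weighted_bound[OF r] by auto
    have lu: "lu_norm v a powr\<^sub>e r = (\<Sum>j. a j powr\<^sub>e r)" for a
      using False r by (simp add: lu_norm_def r_def[symmetric] enn_powr_powr)
    have "weighted_bound r N (\<lambda>y. lu_norm v (\<lambda>j. wmax lborel (g j) y)) (\<lambda>y. lu_norm v (\<lambda>j. g j y))"
      if [measurable]: "\<And>j. g j \<in> borel_measurable borel" for g :: "nat \<Rightarrow> real \<Rightarrow> ennreal"
      unfolding weighted_bound_def
    proof (intro conjI allI impI)
      fix c :: real and a b assume c: "0 < c" and a: "A1 c a" and b: "A1 c b"
      note [measurable] = A1_measurable[OF a] A1_measurable[OF b]
      have sum: "(\<integral>\<^sup>+x. lu_norm v (\<lambda>j. h j x) powr\<^sub>e r * ennreal (factored_weight (r - 1) a b x) \<partial>lborel)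
        = (\<Sum>j. \<integral>\<^sup>+x. h j x powr\<^sub>e r * ennreal (factored_weight (r - 1) a b x) \<partial>lborel)"
        if [measurable]: "\<And>j. h j \<in> borel_measurable borel" for h :: "nat \<Rightarrow> real \<Rightarrow> ennreal"
        unfolding lu ennreal_suminf_multc[symmetric] by (rule nn_integral_suminf) measurable
      have "(\<Sum>j. \<integral>\<^sup>+x. wmax lborel (g j) x powr\<^sub>e r * ennreal (factored_weight (r - 1) a b x) \<partial>lborel)
        \<le> (\<Sum>j. ennreal (N c) * (\<integral>\<^sup>+x. g j x powr\<^sub>e r * ennreal (factored_weight (r - 1) a b x) \<partial>lborel))"
        using N[OF that] c a b by (intro suminf_le) (auto simp: weighted_bound_def)
      then show "(\<integral>\<^sup>+x. lu_norm v (\<lambda>j. wmax lborel (g j) x) powr\<^sub>e r * ennreal (factored_weight (r - 1) a b x) \<partial>lborel)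
        \<le> ennreal (N c) * (\<integral>\<^sup>+x. lu_norm v (\<lambda>j. g j x) powr\<^sub>e r * ennreal (factored_weight (r - 1) a b x) \<partial>lborel)"
        by (subst (1 2) sum) auto
    qed auto
    then show ?thesis using r by (intro exI[of _ r]) auto
  qed
  then obtain r N where r: "1 < r" and N: "\<And>g. (\<forall>j. g j \<in> borel_measurable borel) \<Longrightarrow>
     weighted_bound r N (\<lambda>y. lu_norm v (\<lambda>j. wmax lborel (g j) y)) (\<lambda>y. lu_norm v (\<lambda>j. g j y))"
    by blast
  obtain K where "\<And>F G. weighted_bound r N F G \<Longrightarrow> weighted_bound q K F G"
    using extrapolation[OF r q] by blast
  with N show ?thesis by blast
qed

text \<open>
  For the exponent \<open>r\<close> itself, the weighted bound passes to the \<open>L\<^sup>r\<close> norm over an additional parameter \<open>z\<close>,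
  since the weight does not depend on \<open>z\<close>.
\<close>

lemma weighted_bound_Fubini:
  fixes F G :: "real \<Rightarrow> real \<Rightarrow> ennreal"
  assumes r: "1 < r"
    and Fm [measurable]: "case_prod F \<in> borel_measurable (lborel \<Otimes>\<^sub>M lborel)"
    and Gm [measurable]: "case_prod G \<in> borel_measurable (lborel \<Otimes>\<^sub>M lborel)"
    and W: "\<And>z. weighted_bound r N (\<lambda>y. F y z) (\<lambda>y. G y z)"
  shows "weighted_bound r N (\<lambda>y. (\<integral>\<^sup>+z. F y z powr\<^sub>e r \<partial>lborel) powr\<^sub>e (1 / r))
     (\<lambda>y. (\<integral>\<^sup>+z. G y z powr\<^sub>e r \<partial>lborel) powr\<^sub>e (1 / r))"
  unfolding weighted_bound_def
proof (intro conjI allI impI)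
  have m: "(\<lambda>y. (\<integral>\<^sup>+z. H y z powr\<^sub>e r \<partial>lborel) powr\<^sub>e (1 / r)) \<in> borel_measurable borel"
    if [measurable]: "case_prod H \<in> borel_measurable (lborel \<Otimes>\<^sub>M lborel)" for H :: "real \<Rightarrow> real \<Rightarrow> ennreal"
  proof -
    have "(\<lambda>y. (\<integral>\<^sup>+z. H y z powr\<^sub>e r \<partial>lborel) powr\<^sub>e (1 / r)) \<in> borel_measurable lborel" by measurable
    then show ?thesis by simp
  qed
  show "(\<lambda>y. (\<integral>\<^sup>+z. F y z powr\<^sub>e r \<partial>lborel) powr\<^sub>e (1 / r)) \<in> borel_measurable borel"
    "(\<lambda>y. (\<integral>\<^sup>+z. G y z powr\<^sub>e r \<partial>lborel) powr\<^sub>e (1 / r)) \<in> borel_measurable borel"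
    by (rule m, measurable)+
  fix c :: real and a b assume c: "0 < c" and a: "A1 c a" and b: "A1 c b"
  note [measurable] = A1_measurable[OF a] A1_measurable[OF b]
  let ?w = "\<lambda>y. ennreal (factored_weight (r - 1) a b y)"
  have swap: "(\<integral>\<^sup>+y. ((\<integral>\<^sup>+z. H y z powr\<^sub>e r \<partial>lborel) powr\<^sub>e (1 / r)) powr\<^sub>e r * ?w y \<partial>lborel)
    = (\<integral>\<^sup>+z. (\<integral>\<^sup>+y. H y z powr\<^sub>e r * ?w y \<partial>lborel) \<partial>lborel)"
    if [measurable]: "case_prod H \<in> borel_measurable (lborel \<Otimes>\<^sub>M lborel)" for H :: "real \<Rightarrow> real \<Rightarrow> ennreal"
  proof -
    have "(\<integral>\<^sup>+y. ((\<integral>\<^sup>+z. H y z powr\<^sub>e r \<partial>lborel) powr\<^sub>e (1 / r)) powr\<^sub>e r * ?w y \<partial>lborel)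
      = (\<integral>\<^sup>+y. (\<integral>\<^sup>+z. H y z powr\<^sub>e r * ?w y \<partial>lborel) \<partial>lborel)"
    proof (rule nn_integral_cong)
      fix y :: real
      have "(\<lambda>z. H y z) \<in> borel_measurable lborel"
        using measurable_Pair2[OF that, of y] by simp
      then show "((\<integral>\<^sup>+z. H y z powr\<^sub>e r \<partial>lborel) powr\<^sub>e (1 / r)) powr\<^sub>e r * ?w y
        = (\<integral>\<^sup>+z. H y z powr\<^sub>e r * ?w y \<partial>lborel)"
        using r by (simp add: enn_powr_powr nn_integral_multc)
    qed
    also have "\<dots> = (\<integral>\<^sup>+z. (\<integral>\<^sup>+y. H y z powr\<^sub>e r * ?w y \<partial>lborel) \<partial>lborel)"
      by (rule lborel_pair.Fubini'[symmetric]) measurable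
    finally show ?thesis .
  qed
  have "(\<integral>\<^sup>+z. (\<integral>\<^sup>+y. F y z powr\<^sub>e r * ?w y \<partial>lborel) \<partial>lborel)
    \<le> (\<integral>\<^sup>+z. ennreal (N c) * (\<integral>\<^sup>+y. G y z powr\<^sub>e r * ?w y \<partial>lborel) \<partial>lborel)"
    using W c a b by (intro nn_integral_mono) (auto simp: weighted_bound_def)
  also have "\<dots> = ennreal (N c) * (\<integral>\<^sup>+z. (\<integral>\<^sup>+y. G y z powr\<^sub>e r * ?w y \<partial>lborel) \<partial>lborel)"
    by (rule nn_integral_cmult) measurable
  finally show "(\<integral>\<^sup>+y. ((\<integral>\<^sup>+z. F y z powr\<^sub>e r \<partial>lborel) powr\<^sub>e (1 / r)) powr\<^sub>e r * ?w y \<partial>lborel)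
    \<le> ennreal (N c) * (\<integral>\<^sup>+y. ((\<integral>\<^sup>+z. G y z powr\<^sub>e r \<partial>lborel) powr\<^sub>e (1 / r)) powr\<^sub>e r * ?w y \<partial>lborel)"
    by (simp only: swap[OF Fm] swap[OF Gm])
qed

text \<open>
  Induction on the number \<open>i\<close> of variables already integrated.  Because all exponents are covered at each stage, the
  next stage may use the exponent \<open>p (Suc i)\<close>, for which Fubini's theorem applies, and then restore all exponents by
  extrapolation.
\<close>

lemma mnorm_maximal_weighted_bound:
  assumes v: "1 < v" and p: "\<And>l. l \<in> {1..<k} \<Longrightarrow> 1 < p l" and "i < k" and s: "1 < s"
  shows "\<exists>N. \<forall>g x. (\<forall>j. g j \<in> borel_measurable RN) \<longrightarrow>
    weighted_bound s N (\<lambda>y. mnorm p i (\<lambda>x. lu_norm v (\<lambda>j. maximal_op k (g j) x)) (x(k := y)))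
      (\<lambda>y. mnorm p i (\<lambda>x. lu_norm v (\<lambda>j. g j x)) (x(k := y)))"
  using \<open>i < k\<close> s
proof (induction i arbitrary: s)
  case 0
  obtain N where N: "\<And>g. (\<forall>j. g j \<in> borel_measurable borel) \<Longrightarrow>
     weighted_bound s N (\<lambda>y. lu_norm v (\<lambda>j. wmax lborel (g j) y)) (\<lambda>y. lu_norm v (\<lambda>j. g j y))"
    using lu_norm_maximal_weighted_bound[OF v 0(2)] by blast
  have "weighted_bound s N (\<lambda>y. lu_norm v (\<lambda>j. maximal_op k (g j) (x(k := y)))) (\<lambda>y. lu_norm v (\<lambda>j. g j (x(k := y))))"
    if [measurable]: "\<And>j. g j \<in> borel_measurable RN" for g and x :: "nat \<Rightarrow> real"
  proof -
    have "(\<lambda>y. g j (x(k := y))) \<in> borel_measurable borel" for j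
      by (rule measurable_compose[OF measurable_upd that]) (auto simp: space_PiM)
    then have "weighted_bound s N (\<lambda>y. lu_norm v (\<lambda>j. wmax lborel (\<lambda>y. g j (x(k := y))) y)) (\<lambda>y. lu_norm v (\<lambda>j. g j (x(k := y))))"
      by (intro N) auto
    then show ?thesis by (simp add: maximal_op_eq_wmax)
  qed
  then show ?case unfolding mnorm.simps by blast
next
  case (Suc i)
  define r where "r = p (Suc i)"
  have r: "1 < r" using p[of "Suc i"] Suc.prems by (simp add: r_def)
  obtain N where N: "\<And>g x. (\<forall>j. g j \<in> borel_measurable RN) \<Longrightarrow>
    weighted_bound r N (\<lambda>y. mnorm p i (\<lambda>x. lu_norm v (\<lambda>j. maximal_op k (g j) x)) (x(k := y)))
      (\<lambda>y. mnorm p i (\<lambda>x. lu_norm v (\<lambda>j. g j x)) (x(k := y)))"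
    using Suc.IH[OF Suc_lessD[OF Suc.prems(1)] r] by blast
  obtain K where K: "\<And>F G. weighted_bound r N F G \<Longrightarrow> weighted_bound s K F G"
    using extrapolation[OF r Suc.prems(2)] by blast
  have "weighted_bound s K (\<lambda>y. mnorm p (Suc i) (\<lambda>x. lu_norm v (\<lambda>j. maximal_op k (g j) x)) (x(k := y)))
      (\<lambda>y. mnorm p (Suc i) (\<lambda>x. lu_norm v (\<lambda>j. g j x)) (x(k := y)))"
    if [measurable]: "\<And>j. g j \<in> borel_measurable RN" for g and x :: "nat \<Rightarrow> real"
  proof (rule K)
    have comm: "x(k := y, Suc i := z) = x(Suc i := z, k := y)" for y z
      using Suc.prems by (intro fun_upd_twist) auto
    have jm: "(\<lambda>(y, z). mnorm p i F (x(Suc i := z, k := y))) \<in> borel_measurable (lborel \<Otimes>\<^sub>M lborel)"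
      if "F \<in> borel_measurable RN" for F
    proof -
      have "(\<lambda>yz. x(Suc i := snd yz, k := fst yz)) \<in> lborel \<Otimes>\<^sub>M lborel \<rightarrow>\<^sub>M RN"
        by (intro measurable_upd) (auto simp: space_PiM)
      from measurable_compose[OF this mnorm_measurable[OF that, of p i]]
      show ?thesis by (simp add: case_prod_beta)
    qed
    show "weighted_bound r N (\<lambda>y. mnorm p (Suc i) (\<lambda>x. lu_norm v (\<lambda>j. maximal_op k (g j) x)) (x(k := y)))
      (\<lambda>y. mnorm p (Suc i) (\<lambda>x. lu_norm v (\<lambda>j. g j x)) (x(k := y)))"
      unfolding mnorm.simps comm r_def[symmetric]
      by (rule weighted_bound_Fubini[OF r]) (auto intro!: jm N that)
  qed
  then show ?case by blast
qed

text \<open>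
  Here the variable \<open>k\<close> itself is integrated, with the exponent \<open>p k\<close> and the trivial weight.
\<close>

lemma maximal_op_mnorm_bound:
  assumes v: "1 < v" and p: "\<And>l. l \<in> {1..n} \<Longrightarrow> 1 < p l" and k: "k \<in> {1..n}"
  shows "\<exists>C. \<forall>g x. (\<forall>j. g j \<in> borel_measurable RN) \<longrightarrow>
    mnorm p n (\<lambda>x. lu_norm v (\<lambda>j. maximal_op k (g j) x)) x
      \<le> ennreal C * mnorm p n (\<lambda>x. lu_norm v (\<lambda>j. g j x)) x"
proof -
  obtain i where i: "k = Suc i" using k by (cases k) auto
  have pk: "1 < p k" using p k by auto
  have "\<exists>N. \<forall>g x. (\<forall>j. g j \<in> borel_measurable RN) \<longrightarrow>
    weighted_bound (p k) N (\<lambda>y. mnorm p i (\<lambda>x. lu_norm v (\<lambda>j. maximal_op k (g j) x)) (x(k := y)))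
      (\<lambda>y. mnorm p i (\<lambda>x. lu_norm v (\<lambda>j. g j x)) (x(k := y)))"
    using p k i pk by (intro mnorm_maximal_weighted_bound v) auto
  then obtain N where N: "\<And>g x. (\<forall>j. g j \<in> borel_measurable RN) \<Longrightarrow>
    weighted_bound (p k) N (\<lambda>y. mnorm p i (\<lambda>x. lu_norm v (\<lambda>j. maximal_op k (g j) x)) (x(k := y)))
      (\<lambda>y. mnorm p i (\<lambda>x. lu_norm v (\<lambda>j. g j x)) (x(k := y)))"
    by blast
  define C where "C = (max 0 (N 1)) powr (1 / p k)"
  have "mnorm p n (\<lambda>x. lu_norm v (\<lambda>j. maximal_op k (g j) x)) x
      \<le> ennreal C * mnorm p n (\<lambda>x. lu_norm v (\<lambda>j. g j x)) x"
    if [measurable]: "\<And>j. g j \<in> borel_measurable RN" for g x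
  proof (rule mnorm_mono_cmult[where k = k])
    fix x :: "nat \<Rightarrow> real"
    let ?F = "\<lambda>x. lu_norm v (\<lambda>j. maximal_op k (g j) x)" and ?G = "\<lambda>x. lu_norm v (\<lambda>j. g j x)"
    have fw: "factored_weight (p k - 1) (\<lambda>x. 1) (\<lambda>x. 1) = (\<lambda>_. 1)" by (simp add: factored_weight_def fun_eq_iff)
    have "(\<integral>\<^sup>+y. mnorm p i ?F (x(k := y)) powr\<^sub>e p k \<partial>lborel)
      \<le> ennreal (N 1) * (\<integral>\<^sup>+y. mnorm p i ?G (x(k := y)) powr\<^sub>e p k \<partial>lborel)"
    proof -
      have "weighted_bound (p k) N (\<lambda>y. mnorm p i ?F (x(k := y))) (\<lambda>y. mnorm p i ?G (x(k := y)))"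
        by (rule N) (use that in auto)
      then have "(\<integral>\<^sup>+y. mnorm p i ?F (x(k := y)) powr\<^sub>e p k * ennreal (factored_weight (p k - 1) (\<lambda>x. 1) (\<lambda>x. 1) y) \<partial>lborel)
        \<le> ennreal (N 1) * (\<integral>\<^sup>+y. mnorm p i ?G (x(k := y)) powr\<^sub>e p k * ennreal (factored_weight (p k - 1) (\<lambda>x. 1) (\<lambda>x. 1) y) \<partial>lborel)"
        unfolding weighted_bound_def using A1_one zero_less_one by blast
      then show ?thesis unfolding fw by simp
    qed
    also have "\<dots> \<le> ennreal (max 0 (N 1)) * (\<integral>\<^sup>+y. mnorm p i ?G (x(k := y)) powr\<^sub>e p k \<partial>lborel)"
      by (intro mult_right_mono ennreal_leI) auto
    finally have "(\<integral>\<^sup>+y. mnorm p i ?F (x(k := y)) powr\<^sub>e p k \<partial>lborel) powr\<^sub>e (1 / p k)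
      \<le> (ennreal (max 0 (N 1)) * (\<integral>\<^sup>+y. mnorm p i ?G (x(k := y)) powr\<^sub>e p k \<partial>lborel)) powr\<^sub>e (1 / p k)"
      using pk by (intro enn_powr_mono) auto
    also have "\<dots> = ennreal C * (\<integral>\<^sup>+y. mnorm p i ?G (x(k := y)) powr\<^sub>e p k \<partial>lborel) powr\<^sub>e (1 / p k)"
      using pk enn_powr_ennreal[of "max 0 (N 1)"] by (simp add: enn_powr_mult C_def)
    finally show "mnorm p k ?F x \<le> ennreal C * mnorm p k ?G x"
      unfolding i by simp
  next
    show "k \<le> n" using k by simp
    show "0 < p l" if "l \<in> {1..n}" for l using p[OF that] by simp
  qed measurable
  then show ?thesis by blast
qed

lemma iter_maximal_mnorm_bound:
  assumes v: "1 < v" and p: "\<And>l. l \<in> {1..n} \<Longrightarrow> 1 < p l" and "k \<le> n"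
  shows "\<exists>C>0. \<forall>g x. (\<forall>j. g j \<in> borel_measurable RN) \<longrightarrow>
    mnorm p n (\<lambda>x. lu_norm v (\<lambda>j. iter_maximal k (g j) x)) x
      \<le> ennreal C * mnorm p n (\<lambda>x. lu_norm v (\<lambda>j. g j x)) x"
  using \<open>k \<le> n\<close>
proof (induction k)
  case 0
  show ?case by (intro exI[of _ 1]) auto
next
  case (Suc k)
  obtain C where C: "0 < C" "\<And>g x. (\<forall>j. g j \<in> borel_measurable RN) \<Longrightarrow>
    mnorm p n (\<lambda>x. lu_norm v (\<lambda>j. iter_maximal k (g j) x)) x
      \<le> ennreal C * mnorm p n (\<lambda>x. lu_norm v (\<lambda>j. g j x)) x"
    using Suc by auto
  have "\<exists>C. \<forall>g x. (\<forall>j. g j \<in> borel_measurable RN) \<longrightarrow>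
    mnorm p n (\<lambda>x. lu_norm v (\<lambda>j. maximal_op (Suc k) (g j) x)) x
      \<le> ennreal C * mnorm p n (\<lambda>x. lu_norm v (\<lambda>j. g j x)) x"
    using Suc.prems by (intro maximal_op_mnorm_bound v p) auto
  then obtain D where D: "\<And>g x. (\<forall>j. g j \<in> borel_measurable RN) \<Longrightarrow>
    mnorm p n (\<lambda>x. lu_norm v (\<lambda>j. maximal_op (Suc k) (g j) x)) x
      \<le> ennreal D * mnorm p n (\<lambda>x. lu_norm v (\<lambda>j. g j x)) x"
    by blast
  have "mnorm p n (\<lambda>x. lu_norm v (\<lambda>j. iter_maximal (Suc k) (g j) x)) x
      \<le> ennreal (max 1 D * C) * mnorm p n (\<lambda>x. lu_norm v (\<lambda>j. g j x)) x"
    if "\<forall>j. g j \<in> borel_measurable RN" for g x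
  proof -
    have "mnorm p n (\<lambda>x. lu_norm v (\<lambda>j. iter_maximal (Suc k) (g j) x)) x
      \<le> ennreal D * mnorm p n (\<lambda>x. lu_norm v (\<lambda>j. iter_maximal k (g j) x)) x"
      unfolding iter_maximal.simps using that by (intro D allI iter_maximal_measurable) auto
    also have "\<dots> \<le> ennreal (max 1 D) * (ennreal C * mnorm p n (\<lambda>x. lu_norm v (\<lambda>j. g j x)) x)"
      by (intro mult_mono ennreal_leI C(2) that) auto
    finally show ?thesis using C(1) by (simp add: ennreal_mult mult.assoc)
  qed
  moreover have "0 < max 1 D * C" using C(1) by simp
  ultimately show ?case by blast
qed

section \<open>Lebesgue measurable functions and their Borel versions\<close>

lemma mnorm_one_eq_PiM:
  assumes [measurable]: "F \<in> borel_measurable RN"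
  shows "mnorm (\<lambda>_. 1) n F x
    = (\<integral>\<^sup>+z. F (\<lambda>i. if i \<in> {1..n} then z i else x i) \<partial>(\<Pi>\<^sub>M i\<in>{1..n}. lborel))"
proof (induction n arbitrary: x)
  case 0
  interpret product_sigma_finite "\<lambda>_::nat. lborel :: real measure" ..
  have "(\<Pi>\<^sub>M i\<in>{1..0::nat}. lborel :: real measure) = (\<Pi>\<^sub>M i\<in>{}. lborel)" by simp
  moreover have "emeasure (\<Pi>\<^sub>M i\<in>{}::nat set. lborel :: real measure) (space (\<Pi>\<^sub>M i\<in>{}::nat set. lborel :: real measure)) = 1"
    using nn_integral_empty[of "\<lambda>_. 1"] by simp
  ultimately show ?case by simp
next
  case (Suc n)
  interpret product_sigma_finite "\<lambda>_::nat. lborel :: real measure" ..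
  have ins: "{1..Suc n} = insert (Suc n) {1..n}" by auto
  let ?f = "\<lambda>z. F (\<lambda>i. if i \<in> {1..Suc n} then z i else x i)"
  have fm: "?f \<in> borel_measurable (\<Pi>\<^sub>M i\<in>insert (Suc n) {1..n}. lborel)"
  proof (rule measurable_compose[OF _ assms], rule measurable_PiM_single')
    fix i :: nat
    show "(\<lambda>z. if i \<in> {1..Suc n} then z i else x i) \<in> (\<Pi>\<^sub>M i\<in>insert (Suc n) {1..n}. lborel) \<rightarrow>\<^sub>M lborel"
      unfolding ins by (cases "i \<in> insert (Suc n) {1..n}") auto
  qed (auto simp: space_PiM)
  have "mnorm (\<lambda>_. 1) (Suc n) F x = (\<integral>\<^sup>+y. mnorm (\<lambda>_. 1) n F (x(Suc n := y)) \<partial>lborel)"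
    by simp
  also have "\<dots> = (\<integral>\<^sup>+y. (\<integral>\<^sup>+z. ?f (z(Suc n := y)) \<partial>(\<Pi>\<^sub>M i\<in>{1..n}. lborel)) \<partial>lborel)"
    unfolding Suc.IH by (intro nn_integral_cong arg_cong[where f = F]) (auto simp: fun_eq_iff)
  also have "\<dots> = (\<integral>\<^sup>+z. ?f z \<partial>(\<Pi>\<^sub>M i\<in>insert (Suc n) {1..n}. lborel))"
    by (rule product_nn_integral_insert_rev[symmetric, OF _ _ fm]) auto
  finally show ?case unfolding ins .
qed

text \<open>
  For the indicator function \<open>E\<close> of a null set, \<open>mnorm (\<lambda>_. 1) k E x = 0\<close> expresses that the section over the
  first \<open>k\<close> variables at \<open>x\<close> is a null set.  Almost all sections of a null set are null sets.
\<close>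

lemma mnorm_one_null_section:
  assumes [measurable]: "E \<in> borel_measurable RN" and "mnorm (\<lambda>_. 1) (Suc k) E x = 0"
  shows "AE y in lborel. mnorm (\<lambda>_. 1) k E (x(Suc k := y)) = 0"
proof -
  have "(\<integral>\<^sup>+y. mnorm (\<lambda>_. 1) k E (x(Suc k := y)) \<partial>lborel) = 0"
    using assms(2) by simp
  moreover have "(\<lambda>y. mnorm (\<lambda>_. 1) k E (x(Suc k := y))) \<in> borel_measurable lborel"
    by (rule measurable_compose[OF measurable_upd mnorm_measurable]) (auto simp: space_PiM)
  ultimately show ?thesis by (simp add: nn_integral_0_iff_AE)
qed

text \<open>
  If \<open>F\<close> and \<open>G\<close> agree off a null set, their norms in the first \<open>k\<close> variables agree wherever the
  section of the null set is null, because almost all further sections are null again.  The set \<open>S\<close> stands for the points of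
  \<open>\<real>\<^sup>n\<close>, to which the agreement is confined.
\<close>

lemma mnorm_cong_null:
  assumes E: "E \<in> borel_measurable RN"
    and S: "\<And>x k y. x \<in> S \<Longrightarrow> k \<in> {1..n} \<Longrightarrow> x(k := y) \<in> S"
    and eq: "\<And>x. x \<in> S \<Longrightarrow> E x = 0 \<Longrightarrow> F x = G x"
    and "k \<le> n" "x \<in> S" "mnorm (\<lambda>_. 1) k E x = 0"
  shows "mnorm p k F x = mnorm p k G x"
  using assms(4-)
proof (induction k arbitrary: x)
  case (Suc k)
  have mem: "Suc k \<in> {1..n}" using Suc.prems(1) by simp
  have "AE y in lborel. mnorm p k F (x(Suc k := y)) = mnorm p k G (x(Suc k := y))"
    using mnorm_one_null_section[OF E Suc.prems(3)]
    by (rule eventually_mono) (rule Suc.IH[OF Suc_leD[OF Suc.prems(1)] S[OF Suc.prems(2) mem]])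
  then have "(\<integral>\<^sup>+y. mnorm p k F (x(Suc k := y)) powr\<^sub>e p (Suc k) \<partial>lborel)
    = (\<integral>\<^sup>+y. mnorm p k G (x(Suc k := y)) powr\<^sub>e p (Suc k) \<partial>lborel)"
    by (intro nn_integral_cong_AE) (auto elim!: eventually_mono)
  then show ?case by simp
qed (simp add: eq)

text \<open>
  The same for iterated maximal functions: \<open>M\<^sub>k\<close> at \<open>x\<close> only depends on the almost everywhere class of the
  function in the \<open>k\<close>-th variable.  For \<open>k = n\<close> the iterated maximal functions agree at every point.
\<close>

lemma iter_maximal_cong_null:
  assumes E: "E \<in> borel_measurable RN"
    and S: "\<And>x k y. x \<in> S \<Longrightarrow> k \<in> {1..n} \<Longrightarrow> x(k := y) \<in> S"
    and eq: "\<And>x. x \<in> S \<Longrightarrow> E x = 0 \<Longrightarrow> F x = G x"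
    and "k \<le> n" "x \<in> S" "mnorm (\<lambda>_. 1) k E x = 0"
  shows "iter_maximal k F x = iter_maximal k G x"
  using assms(4-)
proof (induction k arbitrary: x)
  case (Suc k)
  have mem: "Suc k \<in> {1..n}" using Suc.prems(1) by simp
  have "AE y in lborel. iter_maximal k F (x(Suc k := y)) = iter_maximal k G (x(Suc k := y))"
    using mnorm_one_null_section[OF E Suc.prems(3)]
    by (rule eventually_mono) (rule Suc.IH[OF Suc_leD[OF Suc.prems(1)] S[OF Suc.prems(2) mem]])
  then show ?case by (simp add: maximal_op_eq_wmax wmax_cong_AE)
qed (simp add: eq)

lemma mnorm_powr:
  assumes t: "0 < t" and p: "\<And>i. i \<in> {1..k} \<Longrightarrow> 0 < p i"
  shows "mnorm p k (\<lambda>x. F x powr\<^sub>e (1 / t)) x = mnorm (\<lambda>i. p i / t) k F x powr\<^sub>e (1 / t)"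
  using p
proof (induction k arbitrary: x)
  case (Suc k)
  have "0 < p (Suc k)" using Suc.prems by simp
  then show ?case using Suc t by (simp add: enn_powr_powr)
qed simp

lemma lu_norm_powr:
  assumes t: "0 < t" "ennreal t < u" and v: "v = (if u = \<infinity> then \<infinity> else ennreal (enn2real u / t))"
  shows "lu_norm u (\<lambda>j. a j powr\<^sub>e (1 / t)) = lu_norm v a powr\<^sub>e (1 / t)"
proof (cases "u = \<infinity>")
  case True
  then show ?thesis using t v by (simp add: lu_norm_def SUP_enn_powr)
next
  case False
  have "0 < enn2real u" using t False by (cases u) (auto simp: ennreal_less_iff)
  then show ?thesis using False t v by (simp add: lu_norm_def enn_powr_powr)
qed

text \<open>
  The functions are modified on a common Borel null set of \<open>\<real>\<^sup>n\<close>, and then extended to all of \<open>RN\<close> by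
  disregarding the superfluous coordinates.
\<close>

lemma ex_borel_version:
  assumes G: "\<And>j::nat. G j \<in> borel_measurable (completion (\<Pi>\<^sub>M i\<in>{1..n}. lborel :: real measure))"
  obtains g E where "\<And>j. g j \<in> borel_measurable RN" "E \<in> borel_measurable RN"
    "\<And>x. mnorm (\<lambda>_. 1) n E x = 0"
    "\<And>x j. x \<in> extensional {1..n} \<Longrightarrow> E x = 0 \<Longrightarrow> G j x = (g j x :: ennreal)"
proof -
  let ?P = "\<Pi>\<^sub>M i\<in>{1..n}. lborel :: real measure"
  have "\<forall>j. \<exists>g. g \<in> borel_measurable ?P \<and> (AE x in ?P. G j x = g x)"
    using completion_ex_borel_measurable[OF G] by blast
  from choice[OF this] obtain g where g: "\<And>j. g j \<in> borel_measurable ?P"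
    "\<And>j. AE x in ?P. G j x = g j x" by blast
  have "AE x in ?P. \<forall>j. G j x = g j x" using g(2) by (simp add: AE_all_countable)
  then obtain Z where Z: "{x\<in>space ?P. \<not> (\<forall>j. G j x = g j x)} \<subseteq> Z" "emeasure ?P Z = 0" "Z \<in> sets ?P"
    by (rule AE_E)
  let ?r = "\<lambda>x. restrict x {1..n}"
  have r: "?r \<in> RN \<rightarrow>\<^sub>M ?P" by (rule measurable_restrict_subset) simp
  show ?thesis
  proof
    show "(\<lambda>x. g j (?r x)) \<in> borel_measurable RN" for j
      by (rule measurable_compose[OF r g(1)])
    show Em: "(\<lambda>x. indicator Z (?r x) :: ennreal) \<in> borel_measurable RN"
      by (rule measurable_compose[OF r]) (use Z in simp)
    show "mnorm (\<lambda>_. 1) n (\<lambda>x. indicator Z (?r x)) x = 0" for x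
    proof -
      have "mnorm (\<lambda>_. 1) n (\<lambda>x. indicator Z (?r x)) x
        = (\<integral>\<^sup>+z. indicator Z (?r (\<lambda>i. if i \<in> {1..n} then z i else x i)) \<partial>?P)"
        by (rule mnorm_one_eq_PiM[OF Em])
      also have "\<dots> = (\<integral>\<^sup>+z. indicator Z z \<partial>?P)"
      proof (rule nn_integral_cong)
        fix z assume "z \<in> space ?P"
        then have "?r (\<lambda>i. if i \<in> {1..n} then z i else x i) = z"
          by (auto simp: space_PiM PiE_def extensional_def restrict_def fun_eq_iff)
        then show "indicator Z (?r (\<lambda>i. if i \<in> {1..n} then z i else x i)) = (indicator Z z :: ennreal)"
          by simp
      qed
      also have "\<dots> = 0" using Z by simp
      finally show ?thesis .
    qed
    show "G j x = g j (?r x)" if "x \<in> extensional {1..n}" "indicator Z (?r x) = (0::ennreal)" for x j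
    proof -
      have "?r x = x" using that(1) by (simp add: extensional_restrict)
      moreover have "x \<in> space ?P" using that(1) by (simp add: space_PiM PiE_def)
      ultimately show ?thesis using that(2) Z(1) by (auto simp: indicator_def split: if_splits)
    qed
  qed
qed

theorem theorem1p7:
  fixes n :: nat and p :: "nat \<Rightarrow> real" and u :: ennreal and t :: real
  assumes "1 \<le> n"
    and "\<And>i. i \<in> {1..n} \<Longrightarrow> 0 < p i"
    and "0 < u"
    and "0 < t"
    and "\<And>i. i \<in> {1..n} \<Longrightarrow> t < p i" and "ennreal t < u"
  shows "\<exists>C::real. C > 0 \<and>
    (\<forall>f :: nat \<Rightarrow> (nat \<Rightarrow> real) \<Rightarrow> complex. (\<forall>j. f j \<in> L0 n) \<longrightarrow>
      mixed_norm n p (\<lambda>x. lu_norm u (\<lambda>j. maximal_t n t (f j) x))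
        \<le> ennreal C * mixed_norm n p (\<lambda>x. lu_norm u (\<lambda>j. ennreal (cmod (f j x)))))"
proof -
  note t = \<open>0 < t\<close> and ut = \<open>ennreal t < u\<close>
  define q where "q i = p i / t" for i
  define v where "v = (if u = \<infinity> then \<infinity> else ennreal (enn2real u / t))"
  have q: "1 < q i" if "i \<in> {1..n}" for i using assms(5)[OF that] t by (simp add: q_def)
  have v: "1 < v"
  proof (cases "u = \<infinity>")
    case False
    then have "t < enn2real u" using ut t by (cases u) (auto simp: ennreal_less_iff)
    then show ?thesis using False t by (simp add: v_def one_less_ennreal)
  qed (simp add: v_def)
  obtain C where C: "0 < C" "\<And>g x. (\<forall>j. g j \<in> borel_measurable RN) \<Longrightarrow>
    mnorm q n (\<lambda>x. lu_norm v (\<lambda>j. iter_maximal n (g j) x)) x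
      \<le> ennreal C * mnorm q n (\<lambda>x. lu_norm v (\<lambda>j. g j x)) x"
    using iter_maximal_mnorm_bound[of v n q n, OF v q order_refl] by blast
  have "mixed_norm n p (\<lambda>x. lu_norm u (\<lambda>j. maximal_t n t (f j) x))
        \<le> ennreal (C powr (1 / t)) * mixed_norm n p (\<lambda>x. lu_norm u (\<lambda>j. ennreal (cmod (f j x))))"
    if f: "\<forall>j. f j \<in> L0 n" for f :: "nat \<Rightarrow> (nat \<Rightarrow> real) \<Rightarrow> complex"
  proof -
    define G where "G j y = ennreal (cmod (f j y)) powr\<^sub>e t" for j y
    have "G j \<in> borel_measurable (completion (\<Pi>\<^sub>M i\<in>{1..n}. lborel))" for j
    proof -
      have [measurable]: "f j \<in> borel_measurable (completion (\<Pi>\<^sub>M i\<in>{1..n}. lborel))"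
        using f by (simp add: L0_def)
      show ?thesis unfolding G_def by measurable
    qed
    then obtain g E where g: "\<And>j. g j \<in> borel_measurable RN" and E: "E \<in> borel_measurable RN"
      and E0: "\<And>x. mnorm (\<lambda>_. 1) n E x = 0"
      and Gg: "\<And>x j. x \<in> extensional {1..n} \<Longrightarrow> E x = 0 \<Longrightarrow> G j x = g j x"
      using ex_borel_version[of G n] by metis
    have S: "x(k := y) \<in> extensional {1..n}" if "x \<in> extensional {1..n}" "k \<in> {1..n}" for x :: "nat \<Rightarrow> real" and k y
      using that by (auto simp: extensional_def)
    have base: "(\<lambda>_. undefined) \<in> (extensional {1..n} :: (nat \<Rightarrow> real) set)"
      by (simp add: extensional_def)
    let ?o = "\<lambda>_. undefined :: real"
    have mixed: "mixed_norm n p F = mnorm p n F ?o" for F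
      using assms(1,2) by (rule mixed_norm_eq_mnorm)
    have "mixed_norm n p (\<lambda>x. lu_norm u (\<lambda>j. maximal_t n t (f j) x))
      = mnorm p n (\<lambda>x. lu_norm v (\<lambda>j. iter_maximal n (G j) x) powr\<^sub>e (1 / t)) ?o"
      unfolding mixed maximal_t_def G_def[symmetric, abs_def]
      by (simp add: lu_norm_powr[OF t ut v_def])
    also have "\<dots> = mnorm p n (\<lambda>x. lu_norm v (\<lambda>j. iter_maximal n (g j) x) powr\<^sub>e (1 / t)) ?o"
    proof (rule mnorm_cong_null[OF E S _ order_refl base E0])
      fix x :: "nat \<Rightarrow> real" assume x: "x \<in> extensional {1..n}"
      have "iter_maximal n (G j) x = iter_maximal n (g j) x" for j
        by (rule iter_maximal_cong_null[OF E S Gg order_refl x E0])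
      then show "lu_norm v (\<lambda>j. iter_maximal n (G j) x) powr\<^sub>e (1 / t)
        = lu_norm v (\<lambda>j. iter_maximal n (g j) x) powr\<^sub>e (1 / t)" by simp
    qed
    also have "\<dots> = mnorm q n (\<lambda>x. lu_norm v (\<lambda>j. iter_maximal n (g j) x)) ?o powr\<^sub>e (1 / t)"
      unfolding q_def by (rule mnorm_powr[OF t assms(2)])
    also have "\<dots> \<le> (ennreal C * mnorm q n (\<lambda>x. lu_norm v (\<lambda>j. g j x)) ?o) powr\<^sub>e (1 / t)"
      using t g by (intro enn_powr_mono C) auto
    also have "\<dots> = ennreal (C powr (1 / t)) * mnorm q n (\<lambda>x. lu_norm v (\<lambda>j. g j x)) ?o powr\<^sub>e (1 / t)"
      using t C(1) by (simp add: enn_powr_mult enn_powr_ennreal)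
    also have "mnorm q n (\<lambda>x. lu_norm v (\<lambda>j. g j x)) ?o powr\<^sub>e (1 / t)
      = mnorm p n (\<lambda>x. lu_norm v (\<lambda>j. g j x) powr\<^sub>e (1 / t)) ?o"
      unfolding q_def by (rule mnorm_powr[OF t assms(2), symmetric])
    also have "\<dots> = mnorm p n (\<lambda>x. lu_norm u (\<lambda>j. ennreal (cmod (f j x)))) ?o"
    proof (rule mnorm_cong_null[OF E S _ order_refl base E0])
      fix x :: "nat \<Rightarrow> real" assume x: "x \<in> extensional {1..n}" "E x = 0"
      have "ennreal (cmod (f j x)) = G j x powr\<^sub>e (1 / t)" for j
        using t by (simp add: G_def enn_powr_powr)
      then show "lu_norm v (\<lambda>j. g j x) powr\<^sub>e (1 / t) = lu_norm u (\<lambda>j. ennreal (cmod (f j x)))"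
        by (simp add: lu_norm_powr[OF t ut v_def] Gg[OF x])
    qed
    also have "\<dots> = mixed_norm n p (\<lambda>x. lu_norm u (\<lambda>j. ennreal (cmod (f j x))))"
      by (rule mixed[symmetric])
    finally show ?thesis .
  qed
  moreover have "0 < C powr (1 / t)" using C(1) by simp
  ultimately show ?thesis by blast
qed

end
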